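(* MR-DP is fixed-parameter tractable when parameterized by $b+k$, where $b$ is the budget and $k$ the number of base-paths, and can be solved in $\mathcal O\big(b^k\cdot k^k\cdot|\mathcal G|^{\mathcal O(1)}\big)$ time, where $|\mathcal G|$ is the size of the input temporal $k$-path graph.
   Context: A temporal multigraph $\mathcal G=(V,E,\lambda)$ consists of a directed multigraph $(V,E)$ and a labeling $\lambda$ assigning integer time labels to edges; a pair $(e,t)$ with $t\in\lambda(e)$ is a temporal edge. A temporal path is a sequence of temporal edges $((e_1,t_1),\dots,(e_m,t_m))$ such that $e_1,\dots,e_m$ form a directed path and $t_1<\dots<t_m$. A vertex $u$ reaches $v$ if there is a temporal path from $u$ to $v$; $R^{\mathcal G}(u)$ is the set of vertices reached by $u$. A temporal $k$-path graph is a temporal multigraph $\mathcal G$ together with a collection $\mathcal P=\{P_1,\dots,P_k\}$ of temporal paths (base-paths) whose multiset union of temporal edges is exactly the multiset of temporal edges of $\mathcal G$. A delaying operation is a pair $((e,t),\delta)$ where $(e,t)$ is a temporal edge lying on base-path $P_i$ and $\delta\in\mathbb Z$, $\delta>0$. Applying it sets the label of $(e,t)$ to $t+\delta$ and every edge $e'$ that is the $d$-th edge after $e$ on $P_i$ gets label $\max(\lambda(e'),t+\delta+d)$; all other labels are unchanged. Its cost is $\delta$; a sequence of operations is applied one after another and its cost is the sum of costs. MR-DP: given a temporal $k$-path graph $\mathcal G$, a budget $b\in\mathbb N$ and a vertex $s$, find a sequence of delaying operations of total cost at most $b$ maximizing $|R^{\mathcal G'}(s)|$, where $\mathcal G'$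 is the resulting graph.
   Formalization: The factor b^k in the time bound is read as max(1,b)^k, since for budget b = 0 and k ≥ 1 the stated bound would be 0, which no running time meets; for b ≥ 1 the bound is as stated. *)

theory Defs
  imports Complex_Main "HOL-Library.Multiset" "Graph_Theory.Digraph" "Graph_Theory.Arc_Walk"
begin

section \<open>Temporal k-path graphs and delaying operations\<close>

text \<open>
  Labels form a multiset, because distinct base-paths may use the same edge at the same time
  (possibly only after some delays).
\<close>

record ('a, 'b) temporal_multigraph =
  underlying :: "('a, 'b) pre_digraph"
  labels :: "'b \<Rightarrow> int multiset"

definition temporal_multigraph :: "('a, 'b, 'z) temporal_multigraph_scheme \<Rightarrow> bool" where
  "temporal_multigraph G \<longleftrightarrow>
     fin_digraph (underlying G) \<and> (\<forall>e. e \<notin> arcs (underlying G) \<longrightarrow> labels G e = {#})"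

definition temporal_edges :: "('a, 'b, 'z) temporal_multigraph_scheme \<Rightarrow> ('b \<times> int) multiset" where
  "temporal_edges G = (\<Sum>e\<in>arcs (underlying G). image_mset (Pair e) (labels G e))"

text \<open>The empty path from a vertex to itself is a temporal path.\<close>

definition temporal_path ::
    "('a, 'b, 'z) temporal_multigraph_scheme \<Rightarrow> 'a \<Rightarrow> ('b \<times> int) list \<Rightarrow> 'a \<Rightarrow> bool" where
  "temporal_path G u p v \<longleftrightarrow>
     set p \<subseteq> set_mset (temporal_edges G) \<and>
     pre_digraph.apath (underlying G) u (map fst p) v \<and>
     sorted_wrt (<) (map snd p)"

definition reach_set :: "('a, 'b, 'z) temporal_multigraph_scheme \<Rightarrow> 'a \<Rightarrow> 'a set" where
  "reach_set G u = {v. \<exists>p. temporal_path G u p v}"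

record ('a, 'b) path_graph = "('a, 'b) temporal_multigraph" +
  base_paths :: "('b \<times> int) list list"

definition temporal_k_path_graph :: "nat \<Rightarrow> ('a, 'b) path_graph \<Rightarrow> bool" where
  "temporal_k_path_graph k G \<longleftrightarrow>
     temporal_multigraph G \<and>
     length (base_paths G) = k \<and>
     (\<forall>p\<in>set (base_paths G). \<exists>u v. temporal_path G u p v) \<and>
     (\<Sum>p\<leftarrow>base_paths G. mset p) = temporal_edges G"

definition path_graph_size :: "('a, 'b) path_graph \<Rightarrow> nat" where
  "path_graph_size G = card (verts (underlying G)) + card (arcs (underlying G))
     + size (temporal_edges G) + length (base_paths G)"

text \<open>
  The operation \<open>(i, j, \<delta>)\<close> delays by \<open>\<delta>\<close> the temporal edge at position \<open>j\<close> of the \<open>i\<close>-th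
  base-path (both counted from 0). The pair \<open>(i, j)\<close> rather than \<open>(e, t)\<close> identifies one occurrence
  in the multiset of temporal edges.
\<close>

type_synonym delay_op = "nat \<times> nat \<times> int"

definition delay_path :: "nat \<Rightarrow> int \<Rightarrow> ('b \<times> int) list \<Rightarrow> ('b \<times> int) list" where
  "delay_path j \<delta> p =
     map (\<lambda>l. (fst (p ! l),
               if l < j then snd (p ! l)
               else if l = j then snd (p ! j) + \<delta>
               else max (snd (p ! l)) (snd (p ! j) + \<delta> + int (l - j))))
         [0..<length p]"

definition path_labels :: "('b \<times> int) list \<Rightarrow> 'b \<Rightarrow> int multiset" where
  "path_labels p e = image_mset snd (filter_mset (\<lambda>x. fst x = e) (mset p))"

fun delay_op_valid :: "('a, 'b) path_graph \<Rightarrow> delay_op \<Rightarrow> bool" where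
  "delay_op_valid G (i, j, \<delta>) \<longleftrightarrow>
     i < length (base_paths G) \<and> j < length (base_paths G ! i) \<and> \<delta> > 0"

fun apply_delay :: "('a, 'b) path_graph \<Rightarrow> delay_op \<Rightarrow> ('a, 'b) path_graph" where
  "apply_delay G (i, j, \<delta>) =
     (let p = base_paths G ! i; p' = delay_path j \<delta> p
      in G\<lparr>labels := (\<lambda>e. labels G e - path_labels p e + path_labels p' e),
           base_paths := (base_paths G)[i := p']\<rparr>)"

definition apply_delays :: "('a, 'b) path_graph \<Rightarrow> delay_op list \<Rightarrow> ('a, 'b) path_graph" where
  "apply_delays = foldl apply_delay"

primrec delays_valid :: "('a, 'b) path_graph \<Rightarrow> delay_op list \<Rightarrow> bool" where
  "delays_valid G [] \<longleftrightarrow> True"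
| "delays_valid G (d # ds) \<longleftrightarrow> delay_op_valid G d \<and> delays_valid (apply_delay G d) ds"

definition delays_cost :: "delay_op list \<Rightarrow> int" where
  "delays_cost ds = (\<Sum>(i, j, \<delta>)\<leftarrow>ds. \<delta>)"

definition mrdp_feasible :: "('a, 'b) path_graph \<Rightarrow> nat \<Rightarrow> delay_op list \<Rightarrow> bool" where
  "mrdp_feasible G b ds \<longleftrightarrow> delays_valid G ds \<and> delays_cost ds \<le> int b"

definition mrdp_optimal :: "('a, 'b) path_graph \<Rightarrow> nat \<Rightarrow> 'a \<Rightarrow> delay_op list \<Rightarrow> bool" where
  "mrdp_optimal G b s ds \<longleftrightarrow>
     mrdp_feasible G b ds \<and>
     (\<forall>ds'. mrdp_feasible G b ds' \<longrightarrow>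
        card (reach_set (apply_delays G ds') s) \<le> card (reach_set (apply_delays G ds) s))"


section \<open>Random access machine programs\<close>

text \<open>
  Structured programs for a random access machine with a finite number of memory banks (arrays),
  integer cells and indirect addressing. Running time is the number of elementary operations.
  Since addition and subtraction are the only arithmetic operations, numbers grow by at most one
  bit per operation, so the unit-cost measure is polynomially related to Turing machine time.
\<close>

type_synonym store = "string \<Rightarrow> int \<Rightarrow> int"

datatype aexp = Const int | Read string aexp | Plus aexp aexp | Minus aexp aexp

datatype bexp = Less aexp aexp | Neg bexp | Conj bexp bexp

datatype com =
    SKIP
  | Write string aexp aexp
  | Seq com com
  | IF bexp com com
  | WHILE bexp com

primrec aval :: "aexp \<Rightarrow> store \<Rightarrow> int" where
  "aval (Const c) \<sigma> = c"
| "aval (Read x a) \<sigma> = \<sigma> x (aval a \<sigma>)"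
| "aval (Plus a1 a2) \<sigma> = aval a1 \<sigma> + aval a2 \<sigma>"
| "aval (Minus a1 a2) \<sigma> = aval a1 \<sigma> - aval a2 \<sigma>"

primrec atime :: "aexp \<Rightarrow> nat" where
  "atime (Const c) = 1"
| "atime (Read x a) = atime a + 1"
| "atime (Plus a1 a2) = atime a1 + atime a2 + 1"
| "atime (Minus a1 a2) = atime a1 + atime a2 + 1"

primrec bval :: "bexp \<Rightarrow> store \<Rightarrow> bool" where
  "bval (Less a1 a2) \<sigma> \<longleftrightarrow> aval a1 \<sigma> < aval a2 \<sigma>"
| "bval (Neg b) \<sigma> \<longleftrightarrow> \<not> bval b \<sigma>"
| "bval (Conj b1 b2) \<sigma> \<longleftrightarrow> bval b1 \<sigma> \<and> bval b2 \<sigma>"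

primrec btime :: "bexp \<Rightarrow> nat" where
  "btime (Less a1 a2) = atime a1 + atime a2 + 1"
| "btime (Neg b) = btime b + 1"
| "btime (Conj b1 b2) = btime b1 + btime b2 + 1"

text \<open>\<open>exec c \<sigma> t \<sigma>'\<close>: started in \<open>\<sigma>\<close>, the program \<open>c\<close> halts in \<open>\<sigma>'\<close> after \<open>t\<close> operations.\<close>

inductive exec :: "com \<Rightarrow> store \<Rightarrow> nat \<Rightarrow> store \<Rightarrow> bool" where
  Skip: "exec SKIP \<sigma> 1 \<sigma>"
| Write: "exec (Write x a1 a2) \<sigma> (atime a1 + atime a2 + 1)
            (\<sigma>(x := (\<sigma> x)(aval a1 \<sigma> := aval a2 \<sigma>)))"
| Seq: "exec c1 \<sigma> t1 \<sigma>' \<Longrightarrow> exec c2 \<sigma>' t2 \<sigma>'' \<Longrightarrow> exec (Seq c1 c2) \<sigma> (t1 + t2) \<sigma>''"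
| IfTrue: "bval b \<sigma> \<Longrightarrow> exec c1 \<sigma> t \<sigma>' \<Longrightarrow> exec (IF b c1 c2) \<sigma> (btime b + t + 1) \<sigma>'"
| IfFalse: "\<not> bval b \<sigma> \<Longrightarrow> exec c2 \<sigma> t \<sigma>' \<Longrightarrow> exec (IF b c1 c2) \<sigma> (btime b + t + 1) \<sigma>'"
| WhileFalse: "\<not> bval b \<sigma> \<Longrightarrow> exec (WHILE b c) \<sigma> (btime b + 1) \<sigma>"
| WhileTrue: "bval b \<sigma> \<Longrightarrow> exec c \<sigma> t1 \<sigma>' \<Longrightarrow> exec (WHILE b c) \<sigma>' t2 \<sigma>''
    \<Longrightarrow> exec (WHILE b c) \<sigma> (btime b + 1 + t1 + t2) \<sigma>''"

text \<open>Input and output words are stored with their length in cell 0.\<close>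

definition input_store :: "int list \<Rightarrow> store" where
  "input_store xs = (\<lambda>x i.
     if x = ''in'' \<and> 0 \<le> i \<and> i \<le> int (length xs) then (int (length xs) # xs) ! nat i else 0)"

definition output_word :: "store \<Rightarrow> int list \<Rightarrow> bool" where
  "output_word \<sigma> ys \<longleftrightarrow>
     \<sigma> ''out'' 0 = int (length ys) \<and> (\<forall>i<length ys. \<sigma> ''out'' (int i + 1) = ys ! i)"

definition computable :: "(nat \<Rightarrow> nat) \<Rightarrow> bool" where
  "computable f \<longleftrightarrow>
     (\<exists>c. \<forall>n. \<exists>t \<sigma>. exec c (input_store [int n]) t \<sigma> \<and> output_word \<sigma> [int (f n)])"

record 'i problem =
  instances :: "'i set"
  encode :: "'i \<Rightarrow> int list"
  solution :: "'i \<Rightarrow> int list \<Rightarrow> bool"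

definition solves_within :: "com \<Rightarrow> 'i problem \<Rightarrow> ('i \<Rightarrow> nat) \<Rightarrow> bool" where
  "solves_within c \<Pi> T \<longleftrightarrow>
     (\<forall>x\<in>instances \<Pi>. \<exists>t \<sigma> ys. exec c (input_store (encode \<Pi> x)) t \<sigma> \<and>
        output_word \<sigma> ys \<and> solution \<Pi> x ys \<and> t \<le> T x)"

definition fixed_parameter_tractable :: "'i problem \<Rightarrow> ('i \<Rightarrow> nat) \<Rightarrow> ('i \<Rightarrow> nat) \<Rightarrow> bool" where
  "fixed_parameter_tractable \<Pi> \<kappa> sz \<longleftrightarrow>
     (\<exists>c f d. computable f \<and> solves_within c \<Pi> (\<lambda>x. f (\<kappa> x) * sz x ^ d))"


section \<open>MR-DP as a computational problem\<close>

record mrdp_instance =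
  the_graph :: "(nat, nat) path_graph"
  budget :: nat
  source :: nat

definition num_paths :: "mrdp_instance \<Rightarrow> nat" where
  "num_paths x = length (base_paths (the_graph x))"

definition graph_size :: "mrdp_instance \<Rightarrow> nat" where
  "graph_size x = path_graph_size (the_graph x)"

text \<open>To serve as machine input, vertices and edges are numbered consecutively from 0.\<close>

definition mrdp_instances :: "mrdp_instance set" where
  "mrdp_instances = {x. let G = the_graph x in
     temporal_k_path_graph (num_paths x) G \<and>
     (\<exists>n. verts (underlying G) = {..<n}) \<and>
     (\<exists>m. arcs (underlying G) = {..<m}) \<and>
     source x \<in> verts (underlying G)}"

text \<open>The labelling is not listed separately, as it is determined by the base-paths.\<close>

definition mrdp_encode :: "mrdp_instance \<Rightarrow> int list" where
  "mrdp_encode x =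
     (let D = underlying (the_graph x); m = card (arcs D)
      in [int (budget x), int (source x), int (card (verts D)), int m, int (num_paths x)]
         @ map (\<lambda>e. int (tail D e)) [0..<m]
         @ map (\<lambda>e. int (head D e)) [0..<m]
         @ concat (map (\<lambda>p. int (length p) # concat (map (\<lambda>(e, t). [int e, t]) p))
                       (base_paths (the_graph x))))"

definition delays_encode :: "delay_op list \<Rightarrow> int list" where
  "delays_encode ds = concat (map (\<lambda>(i, j, \<delta>). [int i, int j, \<delta>]) ds)"

definition MR_DP :: "mrdp_instance problem" where
  "MR_DP = \<lparr>instances = mrdp_instances, encode = mrdp_encode,
     solution = (\<lambda>x ys. \<exists>ds. ys = delays_encode ds \<and>
                   mrdp_optimal (the_graph x) (budget x) (source x) ds)\<rparr>"

end

theory Submission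
  imports Defs
begin

text \<open>
  Without loss of generality a solution delays every base-path at most once, namely at the first edge at which
  the path is boarded: later delays only hurt, and earlier ones reach the boarding edge with at most
  the same effect. So a solution is determined by the vector \<open>d\<close> of delays per path together with
  the boarding edges. For a fixed \<open>d\<close>, boarding each path as early as possible is
  optimal, because a path delayed by \<open>d i\<close> at an earlier edge is nowhere later than one
  delayed by \<open>d i\<close> at a later edge. The greedy boarding edges are found by \<open>k\<close> rounds of
  relaxation, since in any competing solution the paths can be ordered by their boarding times and
  each round settles the next one. Running this for all \<open>(b + 1)^k \<le> 2 max(1, b)^k k^k\<close>
  vectors with entries at most \<open>b\<close> gives the time bound.
\<close>

section \<open>Running programs\<close>

text \<open>That one delay per path suffices is not shown by transforming a given sequence of
  operations. A competing sequence enters only through its final labels: they are nowhere below the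
  old ones, grow by at least one per edge along each path, and exceed the old label at the first
  used edge of path \<open>i\<close> by \<open>d i\<close>, which is at most the cost spent on that
  path. The comparison with greedy boarding then consists of inequalities, so the two solutions need
  not board at the same edges. Correctness splits into two invariants of the boarding edges:
  \<open>sound\<close>, from which actual operations are built, and \<open>complete\<close>, which
  bounds every competitor with vector \<open>d\<close>. Vectors whose sum exceeds the budget are run
  as well and discarded, which keeps the enumeration a plain counter. The polynomial factor is a
  cube, coming from \<open>k\<close> rounds over all pairs of edges.\<close>

primrec writes :: "com \<Rightarrow> string set" where
  "writes SKIP = {}"
| "writes (Write x a1 a2) = {x}"
| "writes (Seq c1 c2) = writes c1 \<union> writes c2"
| "writes (IF g c1 c2) = writes c1 \<union> writes c2"
| "writes (WHILE g c) = writes c"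

definition agree_off :: "string set \<Rightarrow> store \<Rightarrow> store \<Rightarrow> bool" where
  "agree_off X \<sigma> \<sigma>' \<longleftrightarrow> (\<forall>x. x \<notin> X \<longrightarrow> \<sigma>' x = \<sigma> x)"

lemma agree_offD: "agree_off X \<sigma> \<sigma>' \<Longrightarrow> x \<notin> X \<Longrightarrow> \<sigma>' x = \<sigma> x"
  by (simp add: agree_off_def)

lemma exec_agree_off: "exec c \<sigma> t \<sigma>' \<Longrightarrow> agree_off (writes c) \<sigma> \<sigma>'"
  by (induction rule: exec.induct) (auto simp: agree_off_def)

definition runs :: "com \<Rightarrow> store \<Rightarrow> nat \<Rightarrow> (store \<Rightarrow> bool) \<Rightarrow> bool" where
  "runs c \<sigma> T Q \<longleftrightarrow> (\<exists>t \<sigma>'. exec c \<sigma> t \<sigma>' \<and> t \<le> T \<and> Q \<sigma>')"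

text \<open>A run changes only the banks in \<open>writes c\<close>. Since \<open>runs_mono\<close>
  and \<open>runs_Seq\<close> pass this fact on, loop invariants mention only the banks that the
  loop modifies.\<close>

lemma runs_frame:
  assumes "runs c \<sigma> T Q"
  shows "runs c \<sigma> T (\<lambda>\<sigma>'. Q \<sigma>' \<and> agree_off (writes c) \<sigma> \<sigma>')"
  using assms exec_agree_off unfolding runs_def by blast

lemma runs_mono:
  assumes "runs c \<sigma> T Q" "T \<le> T'"
    and "\<And>\<sigma>'. Q \<sigma>' \<Longrightarrow> agree_off (writes c) \<sigma> \<sigma>' \<Longrightarrow> Q' \<sigma>'"
  shows "runs c \<sigma> T' Q'"
  using runs_frame[OF assms(1)] assms(2,3) unfolding runs_def by (meson le_trans)

lemma runs_Skip: "Q \<sigma> \<Longrightarrow> runs SKIP \<sigma> 1 Q"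
  unfolding runs_def using exec.Skip by blast

lemma runs_Write:
  assumes "Q (\<sigma>(x := (\<sigma> x)(aval a1 \<sigma> := aval a2 \<sigma>)))"
  shows "runs (Write x a1 a2) \<sigma> (atime a1 + atime a2 + 1) Q"
  unfolding runs_def using exec.Write assms by blast

lemma runs_Seq:
  assumes "runs c1 \<sigma> T1 Q1"
    and "\<And>\<sigma>'. Q1 \<sigma>' \<Longrightarrow> agree_off (writes c1) \<sigma> \<sigma>' \<Longrightarrow> runs c2 \<sigma>' T2 Q"
  shows "runs (Seq c1 c2) \<sigma> (T1 + T2) Q"
proof -
  obtain t \<sigma>' where 1: "exec c1 \<sigma> t \<sigma>'" "t \<le> T1" "Q1 \<sigma>'" "agree_off (writes c1) \<sigma> \<sigma>'"
    using runs_frame[OF assms(1)] unfolding runs_def by blast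
  then obtain t' \<sigma>'' where "exec c2 \<sigma>' t' \<sigma>''" "t' \<le> T2" "Q \<sigma>''"
    using assms(2) unfolding runs_def by blast
  with 1 show ?thesis
    unfolding runs_def by (meson add_mono exec.Seq)
qed

lemma runs_IF:
  assumes "bval g \<sigma> \<Longrightarrow> runs c1 \<sigma> T Q" "\<not> bval g \<sigma> \<Longrightarrow> runs c2 \<sigma> T Q"
  shows "runs (IF g c1 c2) \<sigma> (btime g + T + 1) Q"
proof (cases "bval g \<sigma>")
  case True
  with assms(1) obtain t \<sigma>' where "exec c1 \<sigma> t \<sigma>'" "t \<le> T" "Q \<sigma>'" unfolding runs_def by blast
  then show ?thesis
    unfolding runs_def using exec.IfTrue[OF True] by (intro exI[of _ "btime g + t + 1"] exI) auto
next
  case False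
  with assms(2) obtain t \<sigma>' where "exec c2 \<sigma> t \<sigma>'" "t \<le> T" "Q \<sigma>'" unfolding runs_def by blast
  then show ?thesis
    unfolding runs_def using exec.IfFalse[OF False] by (intro exI[of _ "btime g + t + 1"] exI) auto
qed

text \<open>Meant for loops whose number \<open>R\<close> of iterations is known beforehand: the
  invariant is indexed by the completed iterations, and the induction runs over the remaining
  ones.\<close>

lemma runs_WHILE:
  assumes "I 0 \<sigma>"
    and step: "\<And>r \<sigma>'. r < R \<Longrightarrow> I r \<sigma>' \<Longrightarrow> agree_off (writes c) \<sigma> \<sigma>' \<Longrightarrow>
        bval g \<sigma>' \<and> runs c \<sigma>' T (I (Suc r))"
    and stop: "\<And>\<sigma>'. I R \<sigma>' \<Longrightarrow> agree_off (writes c) \<sigma> \<sigma>' \<Longrightarrow> \<not> bval g \<sigma>'"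
    and post: "\<And>\<sigma>'. I R \<sigma>' \<Longrightarrow> agree_off (writes c) \<sigma> \<sigma>' \<Longrightarrow> Q \<sigma>'"
  shows "runs (WHILE g c) \<sigma> (R * (T + btime g + 1) + btime g + 1) Q"
proof -
  have "runs (WHILE g c) \<sigma>' (n * (T + btime g + 1) + btime g + 1) Q"
    if "I (R - n) \<sigma>'" "n \<le> R" "agree_off (writes c) \<sigma> \<sigma>'" for n \<sigma>'
    using that
  proof (induction n arbitrary: \<sigma>')
    case 0
    then show ?case
      using stop post exec.WhileFalse[of g \<sigma>' c] unfolding runs_def by auto
  next
    case (Suc n)
    have g: "bval g \<sigma>'" and "runs c \<sigma>' T (I (Suc (R - Suc n)))"
      using step[of "R - Suc n" \<sigma>'] Suc.prems by auto
    then obtain t \<sigma>'' where 1: "exec c \<sigma>' t \<sigma>''" "t \<le> T" "I (R - n) \<sigma>''"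
      unfolding runs_def using Suc.prems(2) by (auto simp: Suc_diff_Suc)
    have "agree_off (writes c) \<sigma> \<sigma>''"
      using exec_agree_off[OF 1(1)] Suc.prems(3) by (simp add: agree_off_def)
    then obtain t' \<sigma>3 where 2: "exec (WHILE g c) \<sigma>'' t' \<sigma>3"
        "t' \<le> n * (T + btime g + 1) + btime g + 1" "Q \<sigma>3"
      using Suc.IH[of \<sigma>''] 1(3) Suc.prems(2) unfolding runs_def by auto
    have "btime g + 1 + t + t' \<le> Suc n * (T + btime g + 1) + btime g + 1"
      using 1(2) 2(2) by simp
    then show ?case
      using exec.WhileTrue[OF g 1(1) 2(1)] 2(3) unfolding runs_def by blast
  qed
  from this[of R \<sigma>] show ?thesis
    using assms(1) by (simp add: agree_off_def)
qed

abbreviation V :: "string \<Rightarrow> aexp" where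
  "V x \<equiv> Read x (Const 0)"

abbreviation Set :: "string \<Rightarrow> aexp \<Rightarrow> com" where
  "Set x a \<equiv> Write x (Const 0) a"

abbreviation Le :: "aexp \<Rightarrow> aexp \<Rightarrow> bexp" where
  "Le a1 a2 \<equiv> Neg (Less a2 a1)"

abbreviation Eq :: "aexp \<Rightarrow> aexp \<Rightarrow> bexp" where
  "Eq a1 a2 \<equiv> Conj (Le a1 a2) (Le a2 a1)"

abbreviation Disj :: "bexp \<Rightarrow> bexp \<Rightarrow> bexp" where
  "Disj g1 g2 \<equiv> Neg (Conj (Neg g1) (Neg g2))"

definition FOR :: "string \<Rightarrow> aexp \<Rightarrow> com \<Rightarrow> com" where
  "FOR i e c = Seq (Set i (Const 0))
     (WHILE (Less (V i) e) (Seq c (Set i (Plus (V i) (Const 1)))))"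

lemma writes_FOR [simp]: "writes (FOR i e c) = insert i (writes c)"
  by (auto simp: FOR_def)

text \<open>Costs are kept in the form \<open>a * S ^ d\<close>, where \<open>S\<close> bounds every
  loop count, so a loop raises the exponent by one and the coefficient by 30. In each iteration,
  increment and test cost at most 15; initialisation and the final test cost at most 12. By
  \<open>indep\<close>, incrementing the counter does not disturb the invariant.\<close>

lemma runs_FOR:
  assumes i: "i \<notin> writes c"
    and bound: "\<And>\<sigma>'. agree_off (insert i (writes c)) \<sigma> \<sigma>' \<Longrightarrow> aval e \<sigma>' = int n"
    and indep: "\<And>m \<sigma>' f. I m (\<sigma>'(i := f)) = I m \<sigma>'"
    and init: "I 0 \<sigma>"
    and step: "\<And>m \<sigma>'. m < n \<Longrightarrow> I m \<sigma>' \<Longrightarrow> \<sigma>' i 0 = int m \<Longrightarrow>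
       agree_off (insert i (writes c)) \<sigma> \<sigma>' \<Longrightarrow> runs c \<sigma>' (a * S ^ d) (I (Suc m))"
    and time: "n \<le> S" "1 \<le> S" "atime e \<le> 5"
  shows "runs (FOR i e c) \<sigma> ((a + 30) * S ^ Suc d) (I n)"
proof -
  define J where "J = (\<lambda>m \<sigma>'. I m \<sigma>' \<and> \<sigma>' i 0 = int m \<and> agree_off (insert i (writes c)) \<sigma> \<sigma>')"
  define T where "T = n * (a * S ^ d + 6 + btime (Less (V i) e) + 1) + btime (Less (V i) e) + 1"
  have "runs (FOR i e c) \<sigma> (3 + T) (I n)"
    unfolding FOR_def
  proof (rule runs_Seq[where ?Q1.0 = "J 0"])
    have "runs (Set i (Const 0)) \<sigma> (atime (Const 0) + atime (Const 0) + 1) (J 0)"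
      by (rule runs_Write) (simp add: J_def init indep agree_off_def)
    then show "runs (Set i (Const 0)) \<sigma> 3 (J 0)"
      by (simp add: numeral_3_eq_3)
    fix \<sigma>' assume J0: "J 0 \<sigma>'"
    show "runs (WHILE (Less (V i) e) (Seq c (Set i (Plus (V i) (Const 1))))) \<sigma>' T (I n)"
      unfolding T_def
    proof (rule runs_WHILE[where I = J, OF J0])
      fix r \<sigma>'' assume r: "r < n" "J r \<sigma>''"
      have "runs c \<sigma>'' (a * S ^ d) (I (Suc r))"
        using step[of r \<sigma>''] r by (simp add: J_def)
      then have "runs (Seq c (Set i (Plus (V i) (Const 1)))) \<sigma>''
          (a * S ^ d + (atime (Const 0) + atime (Plus (V i) (Const 1)) + 1)) (J (Suc r))"
      proof (rule runs_Seq)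
        fix \<sigma>3 assume 3: "I (Suc r) \<sigma>3" "agree_off (writes c) \<sigma>'' \<sigma>3"
        have "\<sigma>3 i = \<sigma>'' i"
          using 3(2) i by (simp add: agree_off_def)
        moreover have "agree_off (insert i (writes c)) \<sigma> (\<sigma>3(i := f))" for f
          using 3(2) r(2) by (simp add: agree_off_def J_def)
        ultimately show "runs (Set i (Plus (V i) (Const 1))) \<sigma>3
            (atime (Const 0) + atime (Plus (V i) (Const 1)) + 1) (J (Suc r))"
          using 3(1) r(2) by (intro runs_Write) (simp add: J_def indep)
      qed
      then show "bval (Less (V i) e) \<sigma>'' \<and>
          runs (Seq c (Set i (Plus (V i) (Const 1)))) \<sigma>'' (a * S ^ d + 6) (J (Suc r))"
        using r bound[of \<sigma>''] by (auto simp: J_def intro: runs_mono)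
    qed (use bound in \<open>auto simp: J_def\<close>)
  qed
  moreover have "3 + T \<le> (a + 30) * S ^ Suc d"
  proof -
    have p: "1 \<le> S ^ d" "1 \<le> S ^ Suc d"
      using time(2) by auto
    have "T \<le> S * (a * S ^ d + 15 * S ^ d) + 9"
    proof -
      have "btime (Less (V i) e) \<le> 8"
        using time(3) by simp
      moreover from this have "a * S ^ d + 6 + btime (Less (V i) e) + 1 \<le> a * S ^ d + 15 * S ^ d"
        using p(1) by linarith
      then have "n * (a * S ^ d + 6 + btime (Less (V i) e) + 1) \<le> S * (a * S ^ d + 15 * S ^ d)"
        using time(1) by (intro mult_mono) auto
      ultimately show ?thesis
        unfolding T_def by linarith
    qed
    also have "\<dots> = (a + 15) * S ^ Suc d + 9"
      by (simp add: algebra_simps)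
    finally show ?thesis
      using p(2) by (simp add: add_mult_distrib del: power_Suc)
  qed
  ultimately show ?thesis
    by (rule runs_mono)
qed

lemma runs_pow_mono:
  assumes "runs c \<sigma> (a * S ^ d) Q" "a \<le> a'" "d \<le> d'" "1 \<le> S"
    and "\<And>\<sigma>'. Q \<sigma>' \<Longrightarrow> agree_off (writes c) \<sigma> \<sigma>' \<Longrightarrow> Q' \<sigma>'"
  shows "runs c \<sigma> (a' * S ^ d') Q'"
  using assms by (auto intro!: mult_mono power_increasing elim!: runs_mono)

lemma runs_pow_Seq:
  assumes "runs c1 \<sigma> (a1 * S ^ d) Q1"
    and "\<And>\<sigma>'. Q1 \<sigma>' \<Longrightarrow> agree_off (writes c1) \<sigma> \<sigma>' \<Longrightarrow> runs c2 \<sigma>' (a2 * S ^ d) Q"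
  shows "runs (Seq c1 c2) \<sigma> ((a1 + a2) * S ^ d) Q"
  using runs_Seq[OF assms] by (simp add: algebra_simps)

section \<open>Loop-free code, evaluated symbolically\<close>

primrec straight :: "com \<Rightarrow> bool" where
  "straight SKIP \<longleftrightarrow> True"
| "straight (Write x a1 a2) \<longleftrightarrow> True"
| "straight (Seq c1 c2) \<longleftrightarrow> straight c1 \<and> straight c2"
| "straight (IF g c1 c2) \<longleftrightarrow> straight c1 \<and> straight c2"
| "straight (WHILE g c) \<longleftrightarrow> False"

primrec result :: "com \<Rightarrow> store \<Rightarrow> store" where
  "result SKIP \<sigma> = \<sigma>"
| "result (Write x a1 a2) \<sigma> = \<sigma>(x := (\<sigma> x)(aval a1 \<sigma> := aval a2 \<sigma>))"
| "result (Seq c1 c2) \<sigma> = result c2 (result c1 \<sigma>)"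
| "result (IF g c1 c2) \<sigma> = (if bval g \<sigma> then result c1 \<sigma> else result c2 \<sigma>)"
| "result (WHILE g c) \<sigma> = \<sigma>"

text \<open>Both branches of a conditional are added up, which gives a bound that does not depend on
  the store. The clause for loops is a dummy, excluded by \<open>straight\<close>.\<close>

primrec duration :: "com \<Rightarrow> nat" where
  "duration SKIP = 1"
| "duration (Write x a1 a2) = atime a1 + atime a2 + 1"
| "duration (Seq c1 c2) = duration c1 + duration c2"
| "duration (IF g c1 c2) = btime g + (duration c1 + duration c2) + 1"
| "duration (WHILE g c) = 0"

lemma runs_result: "straight c \<Longrightarrow> runs c \<sigma> (duration c) (\<lambda>\<sigma>'. \<sigma>' = result c \<sigma>)"
proof (induction c arbitrary: \<sigma>)
  case SKIP
  then show ?case using runs_Skip[of _ \<sigma>] by simp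
next
  case (Write x a1 a2)
  show ?case
    unfolding duration.simps result.simps by (rule runs_Write) (rule refl)
next
  case (Seq c1 c2)
  show ?case
    using Seq by (simp, intro runs_Seq[OF Seq.IH(1)]) auto
next
  case (IF g c1 c2)
  have "runs (IF g c1 c2) \<sigma> (btime g + (duration c1 + duration c2) + 1)
      (\<lambda>\<sigma>'. \<sigma>' = result (IF g c1 c2) \<sigma>)"
  proof (rule runs_IF)
    show "runs c1 \<sigma> (duration c1 + duration c2) (\<lambda>\<sigma>'. \<sigma>' = result (IF g c1 c2) \<sigma>)" if "bval g \<sigma>"
      by (rule runs_mono[OF IF.IH(1)]) (use IF.prems that in auto)
    show "runs c2 \<sigma> (duration c1 + duration c2) (\<lambda>\<sigma>'. \<sigma>' = result (IF g c1 c2) \<sigma>)" if "\<not> bval g \<sigma>"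
      by (rule runs_mono[OF IF.IH(2)]) (use IF.prems that in auto)
  qed
  then show ?case by simp
qed simp

lemma runs_straight:
  assumes "straight c" "duration c \<le> a" "1 \<le> S" "Q (result c \<sigma>)"
  shows "runs c \<sigma> (a * S ^ d) Q"
proof (rule runs_mono[OF runs_result[OF assms(1)]])
  have "a * 1 \<le> a * S ^ d"
    using assms(3) by (intro mult_le_mono2) simp
  then show "duration c \<le> a * S ^ d" using assms(2) by linarith
qed (use assms(4) in simp)

section \<open>The greedy boarding rule\<close>

text \<open>
  Reachability is tracked on edges instead of vertices, which avoids an arrival time
  \<open>-\<infinity>\<close> at the source.
\<close>

inductive used ::
    "nat \<Rightarrow> (nat \<Rightarrow> 'v) \<Rightarrow> (nat \<Rightarrow> 'v) \<Rightarrow> 'v \<Rightarrow> (nat \<Rightarrow> int) \<Rightarrow> nat \<Rightarrow> bool"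
  for N A B s lam where
  start: "x < N \<Longrightarrow> A x = s \<Longrightarrow> used N A B s lam x"
| step: "used N A B s lam y \<Longrightarrow> x < N \<Longrightarrow> B y = A x \<Longrightarrow> lam y < lam x \<Longrightarrow> used N A B s lam x"

lemma used_less: "used N A B s lam x \<Longrightarrow> x < N"
  by (induction rule: used.induct) auto

text \<open>All that the greedy argument uses once the base-paths are laid out one after another,
  with \<open>P\<close>, \<open>A\<close>, \<open>B\<close>, \<open>L\<close> for path, tail, head
  and label of an edge. Labels are integers, so strict increase along a path means growth by at
  least the index distance; hence a delay passed on along a path never increases.\<close>

locale flat_paths =
  fixes N k :: nat and P :: "nat \<Rightarrow> nat" and A B :: "nat \<Rightarrow> 'v" and L :: "nat \<Rightarrow> int" and s :: 'v
  assumes P_less: "x < N \<Longrightarrow> P x < k"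
    and L_mono: "x \<le> y \<Longrightarrow> y < N \<Longrightarrow> P x = P y \<Longrightarrow> L x + int (y - x) \<le> L y"
    and connected: "Suc x < N \<Longrightarrow> P (Suc x) = P x \<Longrightarrow> A (Suc x) = B x"
    and convex: "x \<le> y \<Longrightarrow> y \<le> z \<Longrightarrow> z < N \<Longrightarrow> P x = P z \<Longrightarrow> P y = P z"
begin

text \<open>
  The edges of all paths are numbered consecutively. \<open>R i\<close> is the edge at which path \<open>i\<close> is
  boarded and delayed by \<open>d i\<close>; the value \<open>R i = N\<close> means that the path is not boarded.
  \<open>arr d R y\<close> is the resulting label of \<open>y\<close>, meaningful only for \<open>R (P y) \<le> y\<close>.
\<close>

definition arr :: "(nat \<Rightarrow> nat) \<Rightarrow> (nat \<Rightarrow> nat) \<Rightarrow> nat \<Rightarrow> int" where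
  "arr d R y = max (L y) (L (R (P y)) + int (d (P y)) + int (y - R (P y)))"

text \<open>The comparison with \<open>arr\<close> is strict because labels increase along a
  temporal path. A departure from \<open>s\<close> holds for every \<open>y\<close>, so a scan over
  all pairs of edges covers both ways of boarding.\<close>

definition can_board :: "(nat \<Rightarrow> nat) \<Rightarrow> (nat \<Rightarrow> nat) \<Rightarrow> nat \<Rightarrow> nat \<Rightarrow> bool" where
  "can_board d R x y \<longleftrightarrow>
     A x = s \<or> R (P y) \<le> y \<and> B y = A x \<and> arr d R y < L x + int (d (P x))"

definition boardings :: "(nat \<Rightarrow> nat) \<Rightarrow> bool" where
  "boardings R \<longleftrightarrow> (\<forall>i<k. R i < N \<longrightarrow> P (R i) = i)"

definition sound :: "(nat \<Rightarrow> nat) \<Rightarrow> (nat \<Rightarrow> nat) \<Rightarrow> bool" where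
  "sound d R \<longleftrightarrow> boardings R \<and> (\<forall>i<k. R i < N \<longrightarrow> (\<exists>y<N. can_board d R (R i) y))"

text \<open>With \<open>i = P y\<close>, the growth of labels gives
  \<open>L (R' i) + (y - R' i) \<le> L (R i) + (y - R i)\<close>, and both sides receive the same
  delay \<open>d i\<close>.\<close>

lemma arr_antimono:
  assumes "boardings R" "boardings R'" "\<forall>i<k. R' i \<le> R i" "R (P y) \<le> y" "y < N"
  shows "arr d R' y \<le> arr d R y"
proof -
  have k: "P y < k" and le: "R' (P y) \<le> R (P y)"
    using assms P_less by auto
  have "P (R (P y)) = P y" "P (R' (P y)) = P y"
    using assms k le unfolding boardings_def by auto
  then have "L (R' (P y)) + int (R (P y) - R' (P y)) \<le> L (R (P y))"
    using le assms by (intro L_mono) auto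
  then show ?thesis
    using le assms(4) unfolding arr_def by (auto simp: max_def of_nat_diff)
qed

lemma can_board_antimono:
  assumes "boardings R" "boardings R'" "\<forall>i<k. R' i \<le> R i" "can_board d R x y" "y < N"
  shows "can_board d R' x y"
  using arr_antimono[OF assms(1-3) _ assms(5), of d] assms(3,4,5) P_less[of y]
  unfolding can_board_def by (meson le_trans order_le_less_trans)

lemma boardings_update: "boardings R \<Longrightarrow> boardings (R(P x := x))"
  unfolding boardings_def by auto

text \<open>Boarding one path earlier can only lower the labels of ridden edges, so the old
  witnesses survive, and \<open>y\<close> justifies the new entry.\<close>

lemma sound_update:
  assumes "sound d R" "can_board d R x y" "x < R (P x)" "y < N" "x < N"
  shows "sound d (R(P x := x))"
  unfolding sound_def
proof (intro conjI allI impI)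
  show b: "boardings (R(P x := x))"
    using assms(1) boardings_update by (simp add: sound_def)
  have mono: "can_board d (R(P x := x)) x' y'" if "can_board d R x' y'" "y' < N" for x' y'
    using can_board_antimono[OF _ b _ that] assms(1,3) by (simp add: sound_def)
  fix i assume "i < k" "(R(P x := x)) i < N"
  then show "\<exists>y<N. can_board d (R(P x := x)) ((R(P x := x)) i) y"
    using assms mono unfolding sound_def by (cases "i = P x") (fastforce, metis fun_upd_other)
qed

lemma sound_init: "\<forall>i<k. R i = N \<Longrightarrow> sound d R"
  unfolding sound_def boardings_def by simp

text \<open>Induction on the label \<open>arr d R x\<close>: unless it departs from
  \<open>s\<close>, the boarding edge of the path of \<open>x\<close> has a witness with a strictly
  smaller label, so chains of witnesses end at \<open>s\<close>. Agreement of \<open>lam\<close>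
  with \<open>arr\<close> is asked only from the boarding edges onwards, where \<open>arr\<close> is
  meaningful.\<close>

lemma sound_used:
  assumes "sound d R" "R (P x) \<le> x" "x < N"
    and lam: "\<And>y. y < N \<Longrightarrow> R (P y) \<le> y \<Longrightarrow> lam y = arr d R y"
  shows "used N A B s lam x"
proof -
  \<comment> \<open>A lower bound of all labels turns the integer labels into a natural-number
    measure.\<close>
  define m where "m = Min (arr d R ` {..<N})"
  have m: "m \<le> arr d R y" if "y < N" for y
    unfolding m_def using that by simp
  show ?thesis
    using assms(2,3)
  proof (induction "nat (arr d R x - m)" arbitrary: x rule: less_induct)
    case less
    define b where "b = R (P x)"
    have k: "P x < k" using less.prems P_less by simp
    have b: "b \<le> x" "b < N" "P b = P x"
      using less.prems k assms(1) unfolding b_def sound_def boardings_def by auto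
    have Rb: "R (P b) = b" using b b_def by simp
    obtain y where y: "y < N" "can_board d R b y"
      using assms(1) k b(2) unfolding sound_def b_def by blast
    have arrb: "arr d R b = L b + int (d (P b))"
      unfolding arr_def Rb by simp
    have arr_le: "arr d R b \<le> arr d R x"
      using Rb b unfolding arr_def b_def[symmetric] by (simp add: max_def)
    have "used N A B s lam b"
    proof (cases "A b = s")
      case True
      then show ?thesis using b by (intro used.start)
    next
      case False
      then have y': "R (P y) \<le> y" "B y = A b" "arr d R y < arr d R b"
        using y(2) unfolding can_board_def arrb by auto
      have uy: "used N A B s lam y"
        using y' y(1) arr_le m[of y] by (intro less.hyps) auto
      have "lam y = arr d R y" "lam b = arr d R b"
        using lam[OF y(1) y'(1)] lam[OF b(2)] Rb by auto
      with y'(3) have "lam y < lam b"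
        by linarith
      with uy b(2) y'(2) show ?thesis
        by (rule used.step)
    qed
    \<comment> \<open>After boarding at \<open>b\<close> the path is ridden edge by edge up to
      \<open>x\<close>; \<open>convex\<close> keeps the intermediate indices on the same
      path.\<close>
    moreover have "used N A B s lam (b + j)" if "b + j \<le> x" "used N A B s lam b" for j
      using that
    proof (induction j)
      case (Suc j)
      have P: "P (b + j) = P x" "P (b + Suc j) = P x"
        using convex[of b "b + j" x] convex[of b "b + Suc j" x] Suc.prems(1) b(3) less.prems(2)
        by simp_all
      have "arr d R (b + j) < arr d R (b + Suc j)"
        using L_mono[of "b + j" "b + Suc j"] P Suc.prems(1) less.prems(2)
        unfolding arr_def P b_def[symmetric] by (simp add: max_def)
      moreover have "lam (b + j) = arr d R (b + j)" "lam (b + Suc j) = arr d R (b + Suc j)"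
        using lam[of "b + j"] lam[of "b + Suc j"] Suc.prems(1) less.prems(2)
        by (simp_all add: P[unfolded add_Suc_right] b_def[symmetric])
      ultimately have lt: "lam (b + j) < lam (b + Suc j)"
        by linarith
      have N: "b + Suc j < N"
        using Suc.prems(1) less.prems(2) by linarith
      have "used N A B s lam (b + j)"
        using Suc by simp
      then show ?case
        by (rule used.step[OF _ N _ lt]) (use connected[of "b + j"] P N in simp)
    qed simp
    from this[of "x - b"] show ?case
      using calculation b by simp
  qed
qed

section \<open>First used edges of a competitor, and their rank by label\<close>

definition first_used :: "(nat \<Rightarrow> int) \<Rightarrow> nat \<Rightarrow> bool" where
  "first_used lam x \<longleftrightarrow> used N A B s lam x \<and> (\<forall>y<x. P y = P x \<longrightarrow> \<not> used N A B s lam y)"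

lemma first_used_exists:
  assumes "used N A B s lam x"
  shows "\<exists>y\<le>x. P y = P x \<and> first_used lam y"
proof -
  obtain y where y: "P y = P x" "used N A B s lam y"
      "\<forall>z<y. \<not> (P z = P x \<and> used N A B s lam z)"
    using assms exists_least_iff[of "\<lambda>y. P y = P x \<and> used N A B s lam y"] by blast
  then have "y \<le> x"
    using assms y(3) linorder_not_less by blast
  moreover have "first_used lam y"
    using y unfolding first_used_def by simp
  ultimately show ?thesis
    using y(1) by blast
qed

lemma first_used_unique: "first_used lam x \<Longrightarrow> first_used lam y \<Longrightarrow> P x = P y \<Longrightarrow> x = y"
  unfolding first_used_def by (metis linorder_neqE_nat)

text \<open>
  Here \<open>lam\<close> stands for the labels after an arbitrary competing sequence of delays, of which \<open>d\<close>
  only remembers the total delay of the first used edge of each path.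
\<close>

definition explained :: "(nat \<Rightarrow> nat) \<Rightarrow> (nat \<Rightarrow> int) \<Rightarrow> bool" where
  "explained d lam \<longleftrightarrow> (\<forall>x<N. L x \<le> lam x) \<and>
     (\<forall>x y. x \<le> y \<longrightarrow> y < N \<longrightarrow> P x = P y \<longrightarrow> lam x + int (y - x) \<le> lam y) \<and>
     (\<forall>x. first_used lam x \<longrightarrow> lam x = L x + int (d (P x)))"

definition rank :: "(nat \<Rightarrow> int) \<Rightarrow> nat \<Rightarrow> nat" where
  "rank lam x = card {y. first_used lam y \<and> lam y < lam x}"

text \<open>Quantifying over all explained labellings lets one \<open>R\<close> dominate every
  competitor with vector \<open>d\<close>. Only \<open>R (P x) \<le> x\<close> is asked: boarding a
  path no later than the competitor suffices to ride every edge that it uses there.\<close>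

definition complete :: "nat \<Rightarrow> (nat \<Rightarrow> nat) \<Rightarrow> (nat \<Rightarrow> nat) \<Rightarrow> bool" where
  "complete r d R \<longleftrightarrow>
     (\<forall>lam x. explained d lam \<longrightarrow> first_used lam x \<longrightarrow> rank lam x < r \<longrightarrow> R (P x) \<le> x)"

lemma finite_first_used: "finite {y. first_used lam y \<and> Q y}"
  by (rule finite_subset[of _ "{..<N}"]) (auto simp: first_used_def dest: used_less)

text \<open>If the competitor boards \<open>x\<close> by changing from \<open>y\<close>, let
  \<open>z\<close> be the first used edge on the path of \<open>y\<close>. Then
  \<open>lam z \<le> lam y < lam x\<close>, so \<open>z\<close> has smaller rank and is covered by
  \<open>R\<close>; hence \<open>arr d R y \<le> lam y\<close>, and the pair is boardable. The
  hypothesis speaks of boardability under the old \<open>R\<close>, which suits a round that updates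
  the entries in place.\<close>

lemma complete_step:
  assumes "complete r d R" "boardings R" "\<forall>i<k. R' i \<le> R i"
    and "\<And>x y. x < N \<Longrightarrow> y < N \<Longrightarrow> can_board d R x y \<Longrightarrow> R' (P x) \<le> x"
  shows "complete (Suc r) d R'"
  unfolding complete_def
proof (intro allI impI)
  fix lam x assume e: "explained d lam" and f: "first_used lam x" and r: "rank lam x < Suc r"
  have x: "x < N" "used N A B s lam x"
    using f by (auto simp: first_used_def dest: used_less)
  have lamx: "lam x = L x + int (d (P x))"
    using e f by (simp add: explained_def)
  show "R' (P x) \<le> x"
  proof (cases "A x = s")
    case True
    then show ?thesis using assms(4)[of x x] x by (simp add: can_board_def)
  next
    case False
    obtain y where y: "used N A B s lam y" "B y = A x" "lam y < lam x"
      using x(2) False by cases auto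
    have yN: "y < N" using used_less[OF y(1)] .
    obtain z where z: "z \<le> y" "P z = P y" "first_used lam z"
      using first_used_exists[OF y(1)] by blast
    have zy: "lam z + int (y - z) \<le> lam y" and Ly: "L y \<le> lam y"
      using e z(1,2) yN unfolding explained_def by blast+
    have "rank lam z < rank lam x"
      unfolding rank_def using z zy y(3)
      by (intro psubset_card_mono finite_first_used) force
    with r have "rank lam z < r"
      by simp
    then have Rz: "R (P y) \<le> z"
      using assms(1) e z(2,3) unfolding complete_def by metis
    have "P (R (P y)) = P y"
      using Rz z yN P_less[OF yN] assms(2) unfolding boardings_def by auto
    \<comment> \<open>The label \<open>lam z\<close> is the original one plus exactly
      \<open>d (P y)\<close>, so boarding at \<open>R (P y) \<le> z\<close> with the same delay is
      no later at \<open>z\<close>, and hence at \<open>y\<close>.\<close>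
    then have "L (R (P y)) + int (z - R (P y)) \<le> L z"
      using Rz z yN by (intro L_mono) auto
    moreover have "lam z = L z + int (d (P y))"
      using e z by (simp add: explained_def)
    ultimately have "arr d R y \<le> lam y"
      using zy Ly Rz z(1) unfolding arr_def by (simp add: max_def of_nat_diff)
    then show ?thesis
      using assms(4)[of x y] x(1) yN y lamx Rz z(1) unfolding can_board_def by simp
  qed
qed

lemma complete_init: "complete 0 d R"
  by (simp add: complete_def)

text \<open>The edges counted by the rank lie on distinct paths, none of them the path of
  \<open>x\<close>; so \<open>k\<close> rounds settle every boarding.\<close>

lemma rank_less:
  assumes "first_used lam x"
  shows "rank lam x < k"
proof -
  have "P ` {y. first_used lam y \<and> lam y < lam x} \<subset> {..<k}"
  proof
    show "P ` {y. first_used lam y \<and> lam y < lam x} \<subseteq> {..<k}"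
      by (auto simp: first_used_def dest!: used_less intro: P_less)
    have "P x \<in> {..<k}"
      using assms by (auto simp: first_used_def dest!: used_less intro: P_less)
    moreover have "P x \<notin> P ` {y. first_used lam y \<and> lam y < lam x}"
      using assms first_used_unique by fastforce
    ultimately show "P ` {y. first_used lam y \<and> lam y < lam x} \<noteq> {..<k}" by blast
  qed
  then have "card (P ` {y. first_used lam y \<and> lam y < lam x}) < card {..<k}"
    by (intro psubset_card_mono) auto
  moreover have "inj_on P {y. first_used lam y \<and> lam y < lam x}"
    using first_used_unique by (auto intro!: inj_onI)
  ultimately show ?thesis
    by (simp add: rank_def card_image)
qed

lemma complete_used:
  assumes "complete k d R" "explained d lam" "used N A B s lam x"
  shows "R (P x) \<le> x"
proof -
  obtain z where z: "z \<le> x" "P z = P x" "first_used lam z"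
    using first_used_exists[OF assms(3)] by blast
  have "R (P z) \<le> z"
    using assms(1,2) z(3) rank_less[OF z(3)] unfolding complete_def by blast
  then show ?thesis
    using z by simp
qed

end

section \<open>Reachability in path graphs\<close>

text \<open>\<open>used\<close> describes time-respecting walks, whereas
  \<open>temporal_path\<close> forbids repeated vertices. Bounding all labels by
  \<open>lam x\<close> is the strengthening that allows the next edge to be appended.\<close>

lemma used_imp_temporal_path:
  assumes "wf_digraph (underlying G)" "s \<in> verts (underlying G)"
    and edges: "set_mset (temporal_edges G) = (\<lambda>x. (E x, lam x)) ` {..<N}"
    and arcs: "\<And>x. x < N \<Longrightarrow> E x \<in> arcs (underlying G)"
    and AB: "\<And>x. x < N \<Longrightarrow> A x = tail (underlying G) (E x)" "\<And>x. x < N \<Longrightarrow> B x = head (underlying G) (E x)"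
    and "used N A B s lam x"
  shows "\<exists>p. temporal_path G s p (B x) \<and> (\<forall>t\<in>snd ` set p. t \<le> lam x)"
proof -
  interpret wf_digraph "underlying G" by fact
  have extend: "\<exists>p. temporal_path G s p (B x) \<and> (\<forall>t\<in>snd ` set p. t \<le> lam x)"
    if x: "x < N" and p: "temporal_path G s p (A x)" and less: "\<forall>t\<in>snd ` set p. t < lam x" for x p
  proof (cases "B x \<in> set (awalk_verts s (map fst p))")
    \<comment> \<open>The head of \<open>x\<close> was visited before, so the prefix of the path
      ending there replaces the extension.\<close>
    case True
    have ap: "apath s (map fst p) (A x)" using p by (simp add: temporal_path_def)
    then obtain q r where qr: "map fst p = q @ r" "awalk s q (B x)"
      using awalk_decomp[OF _ True] unfolding apath_def by blast
    then have q: "q = map fst (take (length q) p)"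
      by (metis append_eq_conv_conj take_map)
    have "apath s q (B x)"
      using ap qr apath_append_iff[of s q r "A x"] by auto
    moreover have "sorted_wrt (<) (map snd (take (length q) p))"
      using p by (simp add: temporal_path_def take_map[symmetric] sorted_wrt_take)
    ultimately have "temporal_path G s (take (length q) p) (B x)"
      using p q set_take_subset[of "length q" p] by (auto simp: temporal_path_def)
    then show ?thesis
      using less set_take_subset[of "length q" p] by (meson image_mono less_imp_le subsetD)
  next
    case False
    have ap: "apath s (map fst p) (A x)" using p by (simp add: temporal_path_def)
    then have last: "awlast s (map fst p) = A x" by (auto simp: apath_def)
    \<comment> \<open>A self-loop falls under the other case, since \<open>A x\<close> is the last
      vertex of the path.\<close>
    have "B x \<noteq> A x"
      using False last by (metis awalk_verts_non_Nil last_in_set)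
    then have "apath s (map fst p @ [E x]) (B x)"
      using ap False AB arcs x last by (auto simp: apath_append_iff apath_simps)
    moreover have "sorted_wrt (<) (map snd p @ [lam x])"
      using p less by (simp add: temporal_path_def sorted_wrt_append)
    ultimately have "temporal_path G s (p @ [(E x, lam x)]) (B x)"
      using p x by (auto simp: temporal_path_def edges)
    then show ?thesis
      using less by (intro exI[of _ "p @ [(E x, lam x)]"]) auto
  qed
  show ?thesis
    using assms(7)
  proof (induction rule: used.induct)
    case (start x)
    have "temporal_path G s [] s"
      using assms(2) by (simp add: temporal_path_def apath_Nil_iff)
    then show ?case
      using extend[of x "[]"] start by simp
  next
    case (step y x)
    then show ?case
      using extend[of x] by (metis le_less_trans)
  qed
qed

text \<open>Several indices may carry the same edge and label. The conclusion therefore names the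
  last temporal edge: its label is what the next edge is compared with, whichever index is
  chosen.\<close>

lemma temporal_path_imp_used:
  assumes "wf_digraph (underlying G)"
    and edges: "set_mset (temporal_edges G) = (\<lambda>x. (E x, lam x)) ` {..<N}"
    and AB: "\<And>x. x < N \<Longrightarrow> A x = tail (underlying G) (E x)" "\<And>x. x < N \<Longrightarrow> B x = head (underlying G) (E x)"
    and "temporal_path G s p v" "p \<noteq> []"
  shows "\<exists>x. used N A B s lam x \<and> last p = (E x, lam x) \<and> B x = v"
proof -
  interpret wf_digraph "underlying G" by fact
  have "awalk s (map fst p) v" "set p \<subseteq> set_mset (temporal_edges G)" "sorted_wrt (<) (map snd p)"
    using assms(5) by (auto simp: temporal_path_def apath_def)
  with \<open>p \<noteq> []\<close> show ?thesis
  proof (induction p arbitrary: v rule: rev_induct)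
    case (snoc a p)
    obtain x where x: "x < N" "a = (E x, lam x)"
      using snoc.prems(3) edges by auto
    have w: "awalk s (map fst p) (A x)" "v = B x"
      using snoc.prems(2) x AB by (auto simp: awalk_simps)
    have "used N A B s lam x"
    proof (cases "p = []")
      case True
      then show ?thesis using w x by (intro used.start) (auto simp: awalk_Nil_iff)
    next
      case False
      then obtain y where y: "used N A B s lam y" "last p = (E y, lam y)" "B y = A x"
        using snoc.IH[OF False w(1)] snoc.prems(3,4) by (auto simp: sorted_wrt_append)
      have "last p \<in> set p" using False by simp
      then have "lam y < lam x"
        using snoc.prems(4) y(2) x(2) by (force simp: sorted_wrt_append)
      then show ?thesis using y x by (intro used.step[OF y(1)]) auto
    qed
    then show ?case using w x by auto
  qed simp
qed

lemma reach_set_eq_used: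
  assumes "wf_digraph (underlying G)" "s \<in> verts (underlying G)"
    and "set_mset (temporal_edges G) = (\<lambda>x. (E x, lam x)) ` {..<N}"
    and "\<And>x. x < N \<Longrightarrow> E x \<in> arcs (underlying G)"
    and "\<And>x. x < N \<Longrightarrow> A x = tail (underlying G) (E x)" "\<And>x. x < N \<Longrightarrow> B x = head (underlying G) (E x)"
  shows "reach_set G s = insert s (B ` {x. used N A B s lam x})"
proof -
  interpret wf_digraph "underlying G" by fact
  have "v \<in> insert s (B ` {x. used N A B s lam x})" if "temporal_path G s p v" for p v
  proof (cases "p = []")
    case True
    then show ?thesis using that by (auto simp: temporal_path_def apath_Nil_iff)
  next
    case False
    then show ?thesis using temporal_path_imp_used[OF assms(1,3,5,6) that] by auto
  qed
  moreover have "temporal_path G s [] s"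
    using assms(2) by (simp add: temporal_path_def apath_Nil_iff)
  ultimately show ?thesis
    using used_imp_temporal_path[OF assms] unfolding reach_set_def by blast
qed

section \<open>Delaying operations\<close>

lemma strict_sorted_int_diff:
  assumes "sorted_wrt (<) (xs :: int list)" "i \<le> j" "j < length xs"
  shows "xs ! i + int (j - i) \<le> xs ! j"
  using assms(2,3)
proof (induction j)
  case (Suc j)
  show ?case
  proof (cases "i = Suc j")
    case False
    then have "xs ! i + int (j - i) \<le> xs ! j" using Suc by simp
    moreover have "xs ! j < xs ! Suc j"
      using assms(1) Suc.prems by (simp add: sorted_wrt_iff_nth_less)
    ultimately show ?thesis
      using False Suc.prems by (simp add: Suc_diff_le)
  qed simp
qed simp

lemma length_delay_path [simp]: "length (delay_path j \<delta> p) = length p"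
  by (simp add: delay_path_def)

lemma map_fst_delay_path [simp]: "map fst (delay_path j \<delta> p) = map fst p"
  by (rule nth_equalityI) (simp_all add: delay_path_def)

lemma nth_delay_path:
  "l < length p \<Longrightarrow> snd (delay_path j \<delta> p ! l) =
     (if l < j then snd (p ! l) else if l = j then snd (p ! j) + \<delta>
      else max (snd (p ! l)) (snd (p ! j) + \<delta> + int (l - j)))"
  by (simp add: delay_path_def)

lemma sorted_delay_path:
  assumes "sorted_wrt (<) (map snd p)" "0 < \<delta>"
  shows "sorted_wrt (<) (map snd (delay_path j \<delta> p))"
  unfolding sorted_wrt_iff_nth_less
proof (intro allI impI)
  fix x y assume xy: "x < y" "y < length (map snd (delay_path j \<delta> p))"
  have "snd (p ! x) < snd (p ! y)"
    using assms(1) xy by (simp add: sorted_wrt_iff_nth_less)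
  moreover have "snd (p ! x) \<le> snd (p ! y)" if "x \<le> y" "y < length p" for x y
    using strict_sorted_int_diff[OF assms(1), of x y] that by simp
  ultimately show "map snd (delay_path j \<delta> p) ! x < map snd (delay_path j \<delta> p) ! y"
    using xy assms(2) by (auto simp: nth_delay_path max_def)
qed

text \<open>For the upper bound at \<open>l > j\<close>: the pushed label
  \<open>snd (p ! j) + \<delta> + (l - j)\<close> is at most \<open>snd (p ! l) + \<delta>\<close>,
  since labels grow by at least one per edge.\<close>

lemma delay_path_bounds:
  assumes "sorted_wrt (<) (map snd p)" "0 < \<delta>" "l < length p"
  shows "snd (p ! l) \<le> snd (delay_path j \<delta> p ! l)"
    and "snd (delay_path j \<delta> p ! l) \<le> snd (p ! l) + \<delta>"
  using assms strict_sorted_int_diff[OF assms(1), of j l] by (auto simp: nth_delay_path)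

text \<open>The invariant of delaying operations. Writing the labels as the sum of the contributions
  of the base-paths makes the multiset subtraction in \<open>apply_delay\<close> exact, since the
  contribution being replaced is contained in the sum.\<close>

definition coherent :: "('a, 'b) path_graph \<Rightarrow> bool" where
  "coherent G \<longleftrightarrow> fin_digraph (underlying G) \<and>
     (\<forall>e. labels G e = (\<Sum>p\<leftarrow>base_paths G. path_labels p e)) \<and>
     (\<forall>p\<in>set (base_paths G). sorted_wrt (<) (map snd p) \<and>
        (\<exists>u v. pre_digraph.awalk (underlying G) u (map fst p) v))"

lemma path_labels_sum_list:
  "image_mset snd (filter_mset (\<lambda>x. fst x = e) (\<Sum>p\<leftarrow>ps. mset p)) = (\<Sum>p\<leftarrow>ps. path_labels p e)"
  by (induction ps) (auto simp: path_labels_def)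

lemma temporal_edges_labels:
  assumes "finite (arcs (underlying G))"
  shows "image_mset snd (filter_mset (\<lambda>x. fst x = e) (temporal_edges G)) =
    (if e \<in> arcs (underlying G) then labels G e else {#})"
proof -
  have 1: "image_mset snd (filter_mset (\<lambda>x. fst x = e) (\<Sum>e'\<in>X. image_mset (Pair e') (labels G e'))) =
    (\<Sum>e'\<in>X. if e' = e then labels G e' else {#})" if "finite X" for X
    using that by (induction X rule: finite_induct) (auto simp: filter_mset_image_mset image_mset.compositionality comp_def)
  show ?thesis
    unfolding temporal_edges_def 1[OF assms] using assms by (simp add: sum.delta)
qed

lemma set_mset_sum:
  "finite X \<Longrightarrow> set_mset (\<Sum>x\<in>X. M x) = (\<Union>x\<in>X. set_mset (M x))"
  by (induction X rule: finite_induct) auto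

lemma coherentI:
  assumes "temporal_k_path_graph k G"
  shows "coherent G"
proof -
  interpret fin_digraph "underlying G"
    using assms by (simp add: temporal_k_path_graph_def temporal_multigraph_def)
  have "labels G e = (\<Sum>p\<leftarrow>base_paths G. path_labels p e)" for e
    using assms temporal_edges_labels[of G e] path_labels_sum_list[of e "base_paths G"]
    by (auto simp: temporal_k_path_graph_def temporal_multigraph_def split: if_splits)
  moreover have "sorted_wrt (<) (map snd p) \<and> (\<exists>u v. awalk u (map fst p) v)"
    if "p \<in> set (base_paths G)" for p
    using assms that unfolding temporal_k_path_graph_def temporal_path_def apath_def by blast
  ultimately show ?thesis
    unfolding coherent_def using fin_digraph_axioms by blast
qed

lemma coherent_edges:
  assumes "coherent G"
  shows "set_mset (temporal_edges G) = (\<Union>p\<in>set (base_paths G). set p)"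
proof -
  interpret fin_digraph "underlying G"
    using assms by (simp add: coherent_def)
  have "e \<in> arcs (underlying G)" if "p \<in> set (base_paths G)" "(e, t) \<in> set p" for p e t
    using assms that by (force simp: coherent_def awalk_def)
  moreover have "t \<in># labels G e \<longleftrightarrow> (\<exists>p\<in>set (base_paths G). (e, t) \<in> set p)" for e t
    using assms by (auto simp: coherent_def path_labels_def set_mset_sum_list image_iff)
  ultimately show ?thesis
    unfolding temporal_edges_def by (auto simp: set_mset_sum[OF finite_arcs] image_iff)
qed

lemma sum_list_update_diff:
  assumes "i < length ps"
  shows "(\<Sum>p\<leftarrow>ps[i := q]. f p) = (\<Sum>p\<leftarrow>ps. f p) - f (ps ! i) + (f q :: 'a multiset)"
proof -
  have "(\<Sum>p\<leftarrow>take i ps @ ps ! i # drop (Suc i) ps. f p) - f (ps ! i) + f q =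
      (\<Sum>p\<leftarrow>take i ps @ q # drop (Suc i) ps. f p)"
    by simp
  then show ?thesis
    using assms by (simp add: upd_conv_take_nth_drop id_take_nth_drop[symmetric])
qed

lemma coherent_apply_delay:
  assumes "coherent G" "delay_op_valid G op"
  shows "coherent (apply_delay G op)"
proof -
  obtain i j \<delta> where op: "op = (i, j, \<delta>)" by (cases op) auto
  have v: "i < length (base_paths G)" "0 < \<delta>" using assms(2) op by auto
  let ?p = "base_paths G ! i"
  have lab: "labels (apply_delay G op) e = (\<Sum>p\<leftarrow>base_paths (apply_delay G op). path_labels p e)" for e
    using assms(1) v(1) by (simp add: op Let_def sum_list_update_diff coherent_def)
  have old: "sorted_wrt (<) (map snd p) \<and> (\<exists>u v. pre_digraph.awalk (underlying G) u (map fst p) v)"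
    if "p \<in> set (base_paths G)" for p
    using assms(1) that by (simp add: coherent_def)
  have new: "sorted_wrt (<) (map snd (delay_path j \<delta> ?p)) \<and>
      (\<exists>u v. pre_digraph.awalk (underlying G) u (map fst (delay_path j \<delta> ?p)) v)"
    using old[OF nth_mem[OF v(1)]] sorted_delay_path[OF _ v(2), of ?p j] by simp
  have "sorted_wrt (<) (map snd p) \<and>
      (\<exists>u v. pre_digraph.awalk (underlying (apply_delay G op)) u (map fst p) v)"
    if "p \<in> set (base_paths (apply_delay G op))" for p
  proof -
    have "p = delay_path j \<delta> ?p \<or> p \<in> set (base_paths G)"
      using that set_update_subset_insert[of "base_paths G" i "delay_path j \<delta> ?p"]
      by (auto simp: op Let_def)
    moreover have "underlying (apply_delay G op) = underlying G"
      by (simp add: op Let_def)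
    ultimately show ?thesis
      using old new by (elim disjE) simp_all
  qed
  moreover have "fin_digraph (underlying (apply_delay G op))"
    using assms(1) by (simp add: op Let_def coherent_def)
  ultimately show ?thesis
    using lab unfolding coherent_def by blast
qed

lemma apply_delay_shape:
  shows "underlying (apply_delay G op) = underlying G"
    and "map (map fst) (base_paths (apply_delay G op)) = map (map fst) (base_paths G)"
    and "length (base_paths (apply_delay G op)) = length (base_paths G)"
    and "length (base_paths (apply_delay G op) ! i) = length (base_paths G ! i)"
proof -
  obtain i' j \<delta> where op: "op = (i', j, \<delta>)" by (cases op) auto
  show "underlying (apply_delay G op) = underlying G"
    "length (base_paths (apply_delay G op)) = length (base_paths G)"
    by (simp_all add: op Let_def)
  show "map (map fst) (base_paths (apply_delay G op)) = map (map fst) (base_paths G)"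
    by (cases "i' < length (base_paths G)")
       (simp_all add: op Let_def map_update list_update_same_conv list_update_beyond)
  show "length (base_paths (apply_delay G op) ! i) = length (base_paths G ! i)"
    by (cases "i' < length (base_paths G)"; cases "i' = i")
       (simp_all add: op Let_def list_update_beyond)
qed

lemma apply_delays_Nil [simp]: "apply_delays G [] = G"
  by (simp add: apply_delays_def)

lemma apply_delays_Cons [simp]: "apply_delays G (op # ds) = apply_delays (apply_delay G op) ds"
  by (simp add: apply_delays_def)

lemma delay_op_valid_apply_delay [simp]:
  "delay_op_valid (apply_delay G op) op' = delay_op_valid G op'"
  by (cases op') (simp add: apply_delay_shape del: apply_delay.simps)

lemma delays_valid_iff: "delays_valid G ds \<longleftrightarrow> (\<forall>op\<in>set ds. delay_op_valid G op)"
  by (induction ds arbitrary: G) auto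

lemma apply_delays_shape:
  assumes "coherent G" "delays_valid G ds"
  shows "coherent (apply_delays G ds)" "underlying (apply_delays G ds) = underlying G"
    and "map (map fst) (base_paths (apply_delays G ds)) = map (map fst) (base_paths G)"
  using assms
  by (induction ds arbitrary: G) (simp_all add: coherent_apply_delay apply_delay_shape del: apply_delay.simps)

text \<open>\<open>D i\<close> is the total cost of the operations on path \<open>i\<close>: each of
  them raises only labels of that path, and none by more than its own cost.\<close>

lemma apply_delays_bounds:
  assumes "coherent G" "delays_valid G ds"
  shows "\<exists>D :: nat \<Rightarrow> nat. int (\<Sum>i<length (base_paths G). D i) = delays_cost ds \<and>
     (\<forall>i<length (base_paths G). \<forall>j<length (base_paths G ! i).
        snd (base_paths G ! i ! j) \<le> snd (base_paths (apply_delays G ds) ! i ! j) \<and>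
        snd (base_paths (apply_delays G ds) ! i ! j) \<le> snd (base_paths G ! i ! j) + int (D i))"
  using assms
proof (induction ds arbitrary: G)
  case Nil
  show ?case by (intro exI[of _ "\<lambda>_. 0"]) (simp add: delays_cost_def)
next
  case (Cons op ds)
  obtain i\<^sub>0 j\<^sub>0 \<delta> where op: "op = (i\<^sub>0, j\<^sub>0, \<delta>)" by (cases op) auto
  let ?G = "apply_delay G op"
  have v: "i\<^sub>0 < length (base_paths G)" "0 < \<delta>" using Cons.prems op by auto
  obtain D where D: "int (\<Sum>i<length (base_paths G). D i) = delays_cost ds"
    "\<And>i j. i<length (base_paths G) \<Longrightarrow> j<length (base_paths G ! i) \<Longrightarrow>
        snd (base_paths ?G ! i ! j) \<le> snd (base_paths (apply_delays ?G ds) ! i ! j) \<and>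
        snd (base_paths (apply_delays ?G ds) ! i ! j) \<le> snd (base_paths ?G ! i ! j) + int (D i)"
    using Cons.IH[of ?G] Cons.prems coherent_apply_delay[of G op]
    by (auto simp: apply_delay_shape simp del: apply_delay.simps)
  let ?D = "D(i\<^sub>0 := D i\<^sub>0 + nat \<delta>)"
  have "(\<Sum>i<length (base_paths G). ?D i) = (\<Sum>i<length (base_paths G). D i) + nat \<delta>"
    using v by (simp add: sum.remove[of _ i\<^sub>0])
  then have "int (\<Sum>i<length (base_paths G). ?D i) = delays_cost (op # ds)"
    using D(1) v by (simp add: delays_cost_def op)
  moreover have "snd (base_paths G ! i ! j) \<le> snd (base_paths (apply_delays ?G ds) ! i ! j) \<and>
        snd (base_paths (apply_delays ?G ds) ! i ! j) \<le> snd (base_paths G ! i ! j) + int (?D i)"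
    if ij: "i<length (base_paths G)" "j<length (base_paths G ! i)" for i j
  proof -
    have "sorted_wrt (<) (map snd (base_paths G ! i))"
      using Cons.prems(1) ij(1) by (simp add: coherent_def)
    from delay_path_bounds[OF this v(2) ij(2), of j\<^sub>0] D(2)[OF ij]
    show ?thesis
      using v by (cases "i = i\<^sub>0") (auto simp: op Let_def)
  qed
  ultimately show ?case
    unfolding apply_delays_Cons by blast
qed

text \<open>With at most one operation per path, no operation acts on a path changed by another, so
  each path can be computed from the input graph.\<close>

lemma base_paths_apply_delays:
  assumes "distinct (map fst ds)" "i < length (base_paths G)"
  shows "base_paths (apply_delays G ds) ! i =
    (case map_of ds i of None \<Rightarrow> base_paths G ! i
     | Some (j, \<delta>) \<Rightarrow> delay_path j \<delta> (base_paths G ! i))"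
  using assms
proof (induction ds arbitrary: G)
  case (Cons op ds)
  obtain i\<^sub>0 j\<^sub>0 \<delta> where op: "op = (i\<^sub>0, j\<^sub>0, \<delta>)" by (cases op) auto
  have "map_of ds i\<^sub>0 = None"
    using Cons.prems(1) op by (simp add: map_of_eq_None_iff)
  moreover have "base_paths (apply_delay G op) ! i =
      (if i = i\<^sub>0 then delay_path j\<^sub>0 \<delta> (base_paths G ! i) else base_paths G ! i)"
    using Cons.prems(2) by (simp add: op Let_def)
  ultimately show ?case
    using Cons.IH[of "apply_delay G op"] Cons.prems op
    by (auto simp: apply_delay_shape simp del: apply_delay.simps split: option.split)
qed simp

section \<open>Optimal delays from greedy boarding\<close>

lemma (in pre_digraph) cas_nth:
  "cas u es v \<Longrightarrow> Suc j < length es \<Longrightarrow> head G (es ! j) = tail G (es ! Suc j)"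
proof (induction u es v arbitrary: j rule: cas.induct)
  case (2 u e es v)
  then show ?case
    by (cases j; cases es) auto
qed simp

locale mrdp_graph =
  fixes G :: "('a, 'b) path_graph" and s :: 'a
  assumes coherent: "coherent G" and source: "s \<in> verts (underlying G)"
begin

definition k :: nat where
  "k = length (base_paths G)"

definition off :: "nat \<Rightarrow> nat" where
  "off i = (\<Sum>i'<i. length (base_paths G ! i'))"

definition N :: nat where
  "N = off k"

text \<open>Empty base-paths occupy no indices: for them \<open>off (Suc i) = off i\<close>, and
  \<open>LEAST\<close> passes over them.\<close>

definition P :: "nat \<Rightarrow> nat" where
  "P x = (LEAST i. x < off (Suc i))"

definition J :: "nat \<Rightarrow> nat" where
  "J x = x - off (P x)"

definition E :: "nat \<Rightarrow> 'b" where
  "E x = fst (base_paths G ! P x ! J x)"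

definition L :: "nat \<Rightarrow> int" where
  "L x = snd (base_paths G ! P x ! J x)"

definition A :: "nat \<Rightarrow> 'a" where
  "A x = tail (underlying G) (E x)"

definition B :: "nat \<Rightarrow> 'a" where
  "B x = head (underlying G) (E x)"

lemma off_0 [simp]: "off 0 = 0"
  by (simp add: off_def)

lemma off_Suc: "off (Suc i) = off i + length (base_paths G ! i)"
  by (simp add: off_def)

lemma off_mono: "i \<le> i' \<Longrightarrow> off i \<le> off i'"
  unfolding off_def by (intro sum_mono2) auto

lemma P_off: "j < length (base_paths G ! i) \<Longrightarrow> P (off i + j) = i"
  unfolding P_def
proof (rule Least_equality)
  fix i' assume j: "j < length (base_paths G ! i)" and i': "off i + j < off (Suc i')"
  show "i \<le> i'"
  proof (rule ccontr)
    assume "\<not> i \<le> i'"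
    then have "off (Suc i') \<le> off i" by (intro off_mono) simp
    with i' show False by simp
  qed
qed (simp add: off_Suc)

lemma J_off: "j < length (base_paths G ! i) \<Longrightarrow> J (off i + j) = j"
  by (simp add: J_def P_off)

lemma flat_index:
  assumes "x < N"
  shows "P x < k" "J x < length (base_paths G ! P x)" "x = off (P x) + J x"
proof -
  have k: "k \<noteq> 0"
    using assms by (intro notI) (simp add: N_def)
  then have x: "x < off (Suc (k - 1))" using assms by (simp add: N_def)
  then have upper: "x < off (Suc (P x))"
    unfolding P_def by (rule LeastI)
  show "P x < k"
    using Least_le[of "\<lambda>i. x < off (Suc i)", OF x] k unfolding P_def by linarith
  have lower: "off (P x) \<le> x"
  proof (cases "P x")
    case (Suc i)
    then have "\<not> x < off (Suc i)"
      using not_less_Least[of i "\<lambda>i. x < off (Suc i)"] unfolding P_def by simp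
    then show ?thesis using Suc by simp
  qed simp
  then show "x = off (P x) + J x" by (simp add: J_def)
  then show "J x < length (base_paths G ! P x)"
    using upper off_Suc[of "P x"] by linarith
qed

lemma J_diff:
  assumes "x \<le> y" "y < N" "P x = P y"
  shows "J y = J x + (y - x)"
proof -
  have "x = off (P y) + J x" "y = off (P y) + J y"
    using flat_index(3)[of x] flat_index(3)[of y] assms by auto
  then show ?thesis
    using assms(1) by linarith
qed

lemma off_less_N:
  assumes "i < k" "j < length (base_paths G ! i)"
  shows "off i + j < N"
  using off_mono[of "Suc i" k] off_Suc[of i] assms unfolding N_def by linarith

lemma path_mem: "i < k \<Longrightarrow> base_paths G ! i \<in> set (base_paths G)"
  by (simp add: k_def)

lemma sorted_path: "i < k \<Longrightarrow> sorted_wrt (<) (map snd (base_paths G ! i))"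
  using coherent path_mem by (simp add: coherent_def)

lemma E_arc:
  assumes "x < N"
  shows "E x \<in> arcs (underlying G)"
proof -
  have "\<exists>u v. pre_digraph.awalk (underlying G) u (map fst (base_paths G ! P x)) v"
    using coherent path_mem[OF flat_index(1)[OF assms]] by (simp add: coherent_def)
  then have "fst ` set (base_paths G ! P x) \<subseteq> arcs (underlying G)"
    by (auto simp: pre_digraph.awalk_def)
  then show ?thesis
    using flat_index(2)[OF assms] unfolding E_def by (meson image_subset_iff nth_mem)
qed

sublocale flat_paths N k P A B L s
proof
  show "P x < k" if "x < N" for x
    using flat_index(1)[OF that] .
  show "L x + int (y - x) \<le> L y" if "x \<le> y" "y < N" "P x = P y" for x y
  proof -
    have "sorted_wrt (<) (map snd (base_paths G ! P y))"
      using flat_index(1) that by (intro sorted_path) auto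
    from strict_sorted_int_diff[OF this, of "J x" "J y"] show ?thesis
      using J_diff[OF that] flat_index(2)[of y] that by (simp add: L_def)
  qed
  show "A (Suc x) = B x" if "Suc x < N" "P (Suc x) = P x" for x
  proof -
    have J: "J (Suc x) = Suc (J x)"
      using J_diff[of x "Suc x"] that by simp
    have "\<exists>u v. pre_digraph.awalk (underlying G) u (map fst (base_paths G ! P x)) v"
      using coherent path_mem[OF flat_index(1)[of x]] that by (simp add: coherent_def)
    then obtain u v where "pre_digraph.cas (underlying G) u (map fst (base_paths G ! P x)) v"
      by (auto simp: pre_digraph.awalk_def)
    from pre_digraph.cas_nth[OF this, of "J x"] show ?thesis
      using J that flat_index(2)[of "Suc x"] by (simp add: A_def B_def E_def)
  qed
  show "P y = P z" if "x \<le> y" "y \<le> z" "z < N" "P x = P z" for x y z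
  proof -
    have x: "x = off (P z) + J x" and z: "z = off (P z) + J z" "J z < length (base_paths G ! P z)"
      using flat_index[of x] flat_index[of z] that by auto
    then have "y = off (P z) + (y - off (P z))" "y - off (P z) < length (base_paths G ! P z)"
      using that by linarith+
    then show ?thesis using P_off by metis
  qed
qed

section \<open>Reach sets after delays, in terms of the numbered edges\<close>

definition delayed_label :: "delay_op list \<Rightarrow> nat \<Rightarrow> int" where
  "delayed_label ds x = snd (base_paths (apply_delays G ds) ! P x ! J x)"

lemma base_paths_delayed:
  assumes "delays_valid G ds"
  shows "length (base_paths (apply_delays G ds)) = k"
    and "i < k \<Longrightarrow> map fst (base_paths (apply_delays G ds) ! i) = map fst (base_paths G ! i)"
    and "i < k \<Longrightarrow> length (base_paths (apply_delays G ds) ! i) = length (base_paths G ! i)"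
proof -
  have m: "map (map fst) (base_paths (apply_delays G ds)) = map (map fst) (base_paths G)"
    using apply_delays_shape[OF coherent assms] by simp
  then show l: "length (base_paths (apply_delays G ds)) = k"
    unfolding k_def using map_eq_imp_length_eq by blast
  show f: "map fst (base_paths (apply_delays G ds) ! i) = map fst (base_paths G ! i)" if "i < k"
    using arg_cong[OF m, of "\<lambda>xs. xs ! i"] that l by (simp add: k_def)
  show "length (base_paths (apply_delays G ds) ! i) = length (base_paths G ! i)" if "i < k"
    using arg_cong[OF f[OF that], of length] by simp
qed

text \<open>An equality of sets suffices, as reachability ignores multiplicities.\<close>

lemma edges_delayed:
  assumes "delays_valid G ds"
  shows "set_mset (temporal_edges (apply_delays G ds)) = (\<lambda>x. (E x, delayed_label ds x)) ` {..<N}"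
proof -
  let ?p = "base_paths (apply_delays G ds)"
  have eq: "?p ! P x ! J x = (E x, delayed_label ds x)" if "x < N" for x
  proof -
    have "map fst (?p ! P x) ! J x = map fst (base_paths G ! P x) ! J x"
      using base_paths_delayed(2)[OF assms flat_index(1)[OF that]] by simp
    then have "fst (?p ! P x ! J x) = E x"
      using base_paths_delayed(3)[OF assms flat_index(1)[OF that]] flat_index(2)[OF that]
      by (simp add: E_def)
    then show ?thesis by (simp add: delayed_label_def prod_eq_iff)
  qed
  have "set_mset (temporal_edges (apply_delays G ds)) = (\<Union>p\<in>set ?p. set p)"
    using coherent_edges apply_delays_shape[OF coherent assms] by blast
  also have "\<dots> = (\<lambda>x. ?p ! P x ! J x) ` {..<N}"
  proof (intro equalityI subsetI)
    fix y assume "y \<in> (\<Union>p\<in>set ?p. set p)"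
    then obtain i j where ij: "i < k" "j < length (base_paths G ! i)" "y = ?p ! i ! j"
      using base_paths_delayed(1,3)[OF assms] by (fastforce simp: in_set_conv_nth)
    then have "y = ?p ! P (off i + j) ! J (off i + j)"
      by (simp add: P_off J_off)
    then show "y \<in> (\<lambda>x. ?p ! P x ! J x) ` {..<N}"
      using off_less_N[OF ij(1,2)] by blast
  next
    fix y assume "y \<in> (\<lambda>x. ?p ! P x ! J x) ` {..<N}"
    then obtain x where x: "x < N" "y = ?p ! P x ! J x" by blast
    have "J x < length (?p ! P x)" "?p ! P x \<in> set ?p"
      using flat_index[OF x(1)] base_paths_delayed[OF assms] by auto
    then show "y \<in> (\<Union>p\<in>set ?p. set p)"
      unfolding x(2) using nth_mem by blast
  qed
  also have "\<dots> = (\<lambda>x. (E x, delayed_label ds x)) ` {..<N}"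
    using eq by (intro image_cong) auto
  finally show ?thesis .
qed

lemma reach_set_delayed:
  assumes "delays_valid G ds"
  shows "reach_set (apply_delays G ds) s = insert s (B ` {x. used N A B s (delayed_label ds) x})"
proof (rule reach_set_eq_used)
  show "wf_digraph (underlying (apply_delays G ds))"
    using apply_delays_shape[OF coherent assms] by (simp add: coherent_def fin_digraph_def)
  show "s \<in> verts (underlying (apply_delays G ds))"
    "\<And>x. x < N \<Longrightarrow> E x \<in> arcs (underlying (apply_delays G ds))"
    "\<And>x. x < N \<Longrightarrow> A x = tail (underlying (apply_delays G ds)) (E x)"
    "\<And>x. x < N \<Longrightarrow> B x = head (underlying (apply_delays G ds)) (E x)"
    using apply_delays_shape(2)[OF coherent assms] source E_arc by (simp_all add: A_def B_def)
qed (rule edges_delayed[OF assms])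

text \<open>The source is left out so that adding it contributes exactly one, whether or not a
  ridden edge returns to it.\<close>

definition boarded :: "(nat \<Rightarrow> nat) \<Rightarrow> 'a set" where
  "boarded R = {B y |y. y < N \<and> R (P y) \<le> y \<and> B y \<noteq> s}"

lemma finite_boarded: "finite (boarded R)"
  by (rule finite_subset[of _ "B ` {..<N}"]) (auto simp: boarded_def)

lemma feasible_bound:
  assumes "mrdp_feasible G b ds"
  obtains d where "\<And>i. i < k \<Longrightarrow> d i \<le> b" "(\<Sum>i<k. d i) \<le> b"
    "\<And>R. complete k d R \<Longrightarrow> card (reach_set (apply_delays G ds) s) \<le> Suc (card (boarded R))"
proof -
  have v: "delays_valid G ds" and c: "delays_cost ds \<le> int b"
    using assms by (auto simp: mrdp_feasible_def)
  obtain D where D: "int (\<Sum>i<k. D i) = delays_cost ds"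
    and bnd: "\<And>i j. i < k \<Longrightarrow> j < length (base_paths G ! i) \<Longrightarrow>
        snd (base_paths G ! i ! j) \<le> snd (base_paths (apply_delays G ds) ! i ! j) \<and>
        snd (base_paths (apply_delays G ds) ! i ! j) \<le> snd (base_paths G ! i ! j) + int (D i)"
    using apply_delays_bounds[OF coherent v] unfolding k_def by blast
  define lam where "lam = delayed_label ds"
  have lam: "L x \<le> lam x" "lam x \<le> L x + int (D (P x))" if "x < N" for x
    using bnd flat_index[OF that] unfolding lam_def L_def delayed_label_def by auto
  define d where "d i = (if \<exists>x. first_used lam x \<and> P x = i
    then nat (lam (THE x. first_used lam x \<and> P x = i) - L (THE x. first_used lam x \<and> P x = i)) else 0)" for i
  have d: "d (P x) = nat (lam x - L x)" if "first_used lam x" for x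
  proof -
    have "(THE y. first_used lam y \<and> P y = P x) = x"
      using that first_used_unique by (intro the_equality) auto
    then show ?thesis using that unfolding d_def by auto
  qed
  have fN: "x < N" if "first_used lam x" for x
    using that used_less[of N A B s lam x] by (simp add: first_used_def)
  have dD: "d i \<le> D i" for i
  proof (cases "\<exists>x. first_used lam x \<and> P x = i")
    case True
    then obtain x where x: "first_used lam x" "P x = i" by blast
    then show ?thesis using d[OF x(1)] lam(2)[OF fN[OF x(1)]] by auto
  next
    case False
    then have "d i = 0" unfolding d_def by (rule if_not_P)
    then show ?thesis by simp
  qed
  have "(\<Sum>i<k. d i) \<le> (\<Sum>i<k. D i)"
    by (intro sum_mono dD)
  then have sum: "(\<Sum>i<k. d i) \<le> b"
    using D c by linarith
  have le: "d i \<le> b" if "i < k" for i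
    using member_le_sum[of i "{..<k}" d] that sum by auto
  have "explained d lam"
    unfolding explained_def
  proof (intro conjI allI impI)
    fix x y assume xy: "x \<le> y" "y < N" "P x = P y"
    have "sorted_wrt (<) (map snd (base_paths (apply_delays G ds) ! P y))"
      using apply_delays_shape(1)[OF coherent v] base_paths_delayed(1)[OF v] flat_index(1)[OF xy(2)]
      by (simp add: coherent_def)
    from strict_sorted_int_diff[OF this, of "J x" "J y"] show "lam x + int (y - x) \<le> lam y"
      using J_diff[OF xy] flat_index(1,2)[OF xy(2)] base_paths_delayed(3)[OF v]
      by (simp add: lam_def delayed_label_def xy(3))
  next
    fix x assume "first_used lam x"
    then show "lam x = L x + int (d (P x))"
      using d lam(1) fN by simp
  qed (use lam in auto)
  have "card (reach_set (apply_delays G ds) s) \<le> Suc (card (boarded R))" if "complete k d R" for R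
  proof -
    have "reach_set (apply_delays G ds) s \<subseteq> insert s (boarded R)"
      using complete_used[OF that \<open>explained d lam\<close>] used_less[of N A B s lam]
      unfolding reach_set_delayed[OF v] lam_def[symmetric] boarded_def by auto
    then have "card (reach_set (apply_delays G ds) s) \<le> card (insert s (boarded R))"
      using finite_boarded by (intro card_mono) auto
    then show ?thesis
      using finite_boarded card_insert_le_m1 by (simp add: boarded_def)
  qed
  with le sum show thesis by (rule that)
qed

text \<open>Operations need a positive delay, so paths with \<open>d i = 0\<close> get none; the
  delay assigned to a path that is never boarded is dropped, which can only save cost.\<close>

definition delay_ops :: "(nat \<Rightarrow> nat) \<Rightarrow> (nat \<Rightarrow> nat) \<Rightarrow> nat \<Rightarrow> delay_op list" where
  "delay_ops d R n = map (\<lambda>i. (i, J (R i), int (d i))) (filter (\<lambda>i. R i < N \<and> 0 < d i) [0..<n])"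

text \<open>On ridden edges these operations produce exactly the labels \<open>arr\<close>, so
  \<open>sound_used\<close> applies to the resulting graph.\<close>

lemma sound_feasible:
  assumes "sound d R" "(\<Sum>i<k. d i) \<le> b"
  shows "mrdp_feasible G b (delay_ops d R k)"
    and "Suc (card (boarded R)) \<le> card (reach_set (apply_delays G (delay_ops d R k)) s)"
proof -
  let ?ds = "delay_ops d R k"
  have R: "P (R i) = i" if "i < k" "R i < N" for i
    using assms(1) that by (simp add: sound_def boardings_def)
  have v: "delays_valid G ?ds"
    unfolding delays_valid_iff delay_ops_def using R flat_index(2) k_def by force
  have "delays_cost ?ds = (\<Sum>i\<leftarrow>filter (\<lambda>i. R i < N \<and> 0 < d i) [0..<k]. int (d i))"
    by (simp add: delays_cost_def delay_ops_def comp_def)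
  also have "\<dots> = (\<Sum>i\<in>{i \<in> {..<k}. R i < N \<and> 0 < d i}. int (d i))"
    by (subst sum_list_distinct_conv_sum_set) (auto intro: sum.cong)
  also have "\<dots> \<le> (\<Sum>i<k. int (d i))"
    by (intro sum_mono2) auto
  finally show "mrdp_feasible G b ?ds"
    using v assms(2) by (simp add: mrdp_feasible_def flip: of_nat_sum)
  have dist: "distinct (map fst ?ds)"
    by (simp add: delay_ops_def comp_def)
  have "map_of ?ds i = (if i < k \<and> R i < N \<and> 0 < d i then Some (J (R i), int (d i)) else None)" for i
    unfolding delay_ops_def map_of_map_restrict by (simp add: restrict_map_def)
  then have paths: "base_paths (apply_delays G ?ds) ! i =
      (if R i < N \<and> 0 < d i then delay_path (J (R i)) (int (d i)) (base_paths G ! i)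
       else base_paths G ! i)" if "i < k" for i
    using base_paths_apply_delays[OF dist, of i G] that by (simp add: k_def)
  have "delayed_label ?ds y = arr d R y" if y: "y < N" "R (P y) \<le> y" for y
  proof -
    define r where "r = R (P y)"
    have r: "P y < k" "r < N" "P r = P y" "r \<le> y"
      using flat_index(1) y R by (auto simp: r_def)
    have Jy: "J y = J r + (y - r)"
      using J_diff[OF r(4) y(1) r(3)] .
    have Lr: "snd (base_paths G ! P y ! J r) = L r" and Ly: "snd (base_paths G ! P y ! J y) = L y"
      using r by (simp_all add: L_def)
    have Lm: "L r + int (y - r) \<le> L y"
      using L_mono[OF r(4) y(1) r(3)] .
    have a: "arr d R y = max (L y) (L r + int (d (P y)) + int (y - r))"
      by (simp add: arr_def r_def)
    show ?thesis
    proof (cases "0 < d (P y)")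
      case True
      then have "delayed_label ?ds y =
          snd (delay_path (J r) (int (d (P y))) (base_paths G ! P y) ! J y)"
        using r by (simp add: delayed_label_def paths r_def)
      also have "\<dots> = (if J y = J r then L r + int (d (P y))
          else max (L y) (L r + int (d (P y)) + int (J y - J r)))"
        using Jy unfolding nth_delay_path[OF flat_index(2)[OF y(1)]] Lr Ly by simp
      also have "\<dots> = arr d R y"
        \<comment> \<open>At the boarding edge \<open>delay_path\<close> takes no maximum; there the
          maximum in \<open>arr\<close> is attained by the delayed label, as the delay is
          positive.\<close>
        unfolding a using Jy Lm r(4) by (cases "y = r") auto
      finally show ?thesis .
    next
      \<comment> \<open>No operation is issued; by the growth of labels the second argument of the
        maximum in \<open>arr\<close> is at most \<open>L y\<close>.\<close>
      case False
      then show ?thesis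
        using r Lm Ly unfolding a by (simp add: delayed_label_def paths)
    qed
  qed
  then have "used N A B s (delayed_label ?ds) y" if "y < N" "R (P y) \<le> y" for y
    using sound_used[OF assms(1) that(2,1)] by simp
  then have sub: "insert s (boarded R) \<subseteq> reach_set (apply_delays G ?ds) s"
    unfolding reach_set_delayed[OF v] boarded_def by auto
  have "{x. used N A B s (delayed_label ?ds) x} \<subseteq> {..<N}"
    using used_less[of N A B s] by auto
  then have "finite (reach_set (apply_delays G ?ds) s)"
    unfolding reach_set_delayed[OF v] using finite_subset by blast
  then have "card (insert s (boarded R)) \<le> card (reach_set (apply_delays G ?ds) s)"
    using sub by (rule card_mono)
  then show "Suc (card (boarded R)) \<le> card (reach_set (apply_delays G ?ds) s)"
    using finite_boarded by (simp add: boarded_def)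
qed

lemma feasible_Nil: "mrdp_feasible G b []"
  by (simp add: mrdp_feasible_def delays_cost_def)

end

section \<open>The program\<close>

abbreviation Inp :: "int \<Rightarrow> aexp" where
  "Inp c \<equiv> Read ''in'' (Const c)"

abbreviation At :: "string \<Rightarrow> string \<Rightarrow> aexp" where
  "At x i \<equiv> Read x (V i)"

text \<open>
  Banks \<open>P\<close>, \<open>J\<close>, \<open>A\<close>, \<open>B\<close>, \<open>L\<close> hold path, position, tail, head and label of the numbered
  edges, \<open>N\<close> their number, \<open>D\<close> the current delay vector and \<open>R\<close> the boarding edges. The scalars
  are \<open>c\<close> (boarded vertices), \<open>u\<close> (sum of the delays), \<open>t\<close> (best count so far), \<open>w\<close> (length
  of the output), \<open>a\<close> (carry), \<open>z\<close> (all vectors tried) and \<open>q\<close> (reading position).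
\<close>

definition read_edge :: com where
  "read_edge =
    Seq (Write ''P'' (V ''N'') (V ''i''))
   (Seq (Write ''J'' (V ''N'') (V ''j''))
   (Seq (Write ''A'' (V ''N'') (Read ''in'' (Plus (Const 6) (At ''in'' ''q''))))
   (Seq (Write ''B'' (V ''N'') (Read ''in'' (Plus (Const 6) (Plus (Inp 4) (At ''in'' ''q'')))))
   (Seq (Write ''L'' (V ''N'') (Read ''in'' (Plus (V ''q'') (Const 1))))
   (Seq (Set ''q'' (Plus (V ''q'') (Const 2)))
        (Set ''N'' (Plus (V ''N'') (Const 1))))))))"

definition parse :: com where
  "parse =
    Seq (Set ''q'' (Plus (Const 6) (Plus (Inp 4) (Inp 4))))
        (FOR ''i'' (Inp 5)
          (Seq (Seq (Set ''l'' (At ''in'' ''q'')) (Set ''q'' (Plus (V ''q'') (Const 1))))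
               (FOR ''j'' (V ''l'') read_edge)))"

text \<open>\<open>arr d R y < L x + d (P x)\<close> is split into one comparison for each argument
  of the maximum. The first conjunct ensures that entries of \<open>R\<close> only decrease.\<close>

definition try_board :: com where
  "try_board = IF
     (Conj (Less (V ''x'') (Read ''R'' (At ''P'' ''x'')))
       (Disj (Eq (At ''A'' ''x'') (Inp 2))
         (Conj (Le (Read ''R'' (At ''P'' ''y'')) (V ''y''))
         (Conj (Eq (At ''B'' ''y'') (At ''A'' ''x''))
         (Conj (Less (At ''L'' ''y'') (Plus (At ''L'' ''x'') (Read ''D'' (At ''P'' ''x''))))
               (Less (Plus (Plus (Read ''L'' (Read ''R'' (At ''P'' ''y''))) (Read ''D'' (At ''P'' ''y'')))
                       (Minus (V ''y'') (Read ''R'' (At ''P'' ''y''))))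
                     (Plus (At ''L'' ''x'') (Read ''D'' (At ''P'' ''x'')))))))))
     (Write ''R'' (At ''P'' ''x'') (V ''x'')) SKIP"

definition board_all :: com where
  "board_all =
    Seq (FOR ''i'' (Inp 5) (Write ''R'' (V ''i'') (V ''N'')))
        (FOR ''r'' (Inp 5) (FOR ''x'' (V ''N'') (FOR ''y'' (V ''N'') try_board)))"

text \<open>The outer loop is over vertices because several ridden edges may share a head.\<close>

definition count_boarded :: com where
  "count_boarded =
    Seq (Set ''c'' (Const 0))
        (FOR ''v'' (Inp 3)
          (Seq (Seq (Set ''f'' (Const 0))
                    (FOR ''y'' (V ''N'')
                      (IF (Conj (Le (Read ''R'' (At ''P'' ''y'')) (V ''y''))
                          (Conj (Eq (At ''B'' ''y'') (V ''v'')) (Neg (Eq (V ''v'') (Inp 2)))))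
                        (Set ''f'' (Const 1)) SKIP)))
               (Set ''c'' (Plus (V ''c'') (V ''f'')))))"

definition sum_delays :: com where
  "sum_delays =
    Seq (Set ''u'' (Const 0)) (FOR ''i'' (Inp 5) (Set ''u'' (Plus (V ''u'') (At ''D'' ''i''))))"

definition emit_op :: com where
  "emit_op = IF (Conj (Less (At ''R'' ''i'') (V ''N'')) (Less (Const 0) (At ''D'' ''i'')))
     (Seq (Write ''out'' (Plus (V ''w'') (Const 1)) (V ''i''))
     (Seq (Write ''out'' (Plus (V ''w'') (Const 2)) (Read ''J'' (At ''R'' ''i'')))
     (Seq (Write ''out'' (Plus (V ''w'') (Const 3)) (At ''D'' ''i''))
          (Set ''w'' (Plus (V ''w'') (Const 3))))))
     SKIP"

text \<open>The output is overwritten from the front and its length is stored last, so leftovers of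
  a longer earlier solution lie beyond the word.\<close>

definition record_best :: com where
  "record_best = IF (Conj (Le (V ''u'') (Inp 1)) (Less (V ''t'') (V ''c'')))
     (Seq (Seq (Set ''t'' (V ''c'')) (Set ''w'' (Const 0)))
     (Seq (FOR ''i'' (Inp 5) emit_op)
          (Write ''out'' (Const 0) (V ''w''))))
     SKIP"

text \<open>A counter in base \<open>b + 1\<close> with carry \<open>a\<close>; a carry out of the
  last digit signals that all vectors have been tried.\<close>

definition next_delays :: com where
  "next_delays =
    Seq (Set ''a'' (Const 1))
   (Seq (FOR ''i'' (Inp 5)
          (IF (Less (Const 0) (V ''a''))
            (IF (Less (At ''D'' ''i'') (Inp 1))
              (Seq (Write ''D'' (V ''i'') (Plus (At ''D'' ''i'') (Const 1))) (Set ''a'' (Const 0)))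
              (Write ''D'' (V ''i'') (Const 0)))
            SKIP))
        (Set ''z'' (V ''a'')))"

definition solve :: com where
  "solve = Seq parse (WHILE (Less (V ''z'') (Const 1))
     (Seq board_all (Seq count_boarded (Seq sum_delays (Seq record_best next_delays)))))"

section \<open>Correctness and running time of the phases of the program\<close>

locale mrdp_machine = mrdp_graph G s for G :: "(nat, nat) path_graph" and s :: nat +
  fixes b n S :: nat
  assumes verts: "verts (underlying G) = {..<n}"
    and size: "1 \<le> S" "n \<le> S" "N \<le> S" "k \<le> S"
begin

definition tables :: "store \<Rightarrow> bool" where
  "tables \<sigma> \<longleftrightarrow> \<sigma> ''in'' 1 = int b \<and> \<sigma> ''in'' 2 = int s \<and> \<sigma> ''in'' 3 = int n \<and>
     \<sigma> ''in'' 5 = int k \<and> \<sigma> ''N'' 0 = int N \<and>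
     (\<forall>x<N. \<sigma> ''P'' (int x) = int (P x) \<and> \<sigma> ''J'' (int x) = int (J x) \<and>
       \<sigma> ''A'' (int x) = int (A x) \<and> \<sigma> ''B'' (int x) = int (B x) \<and> \<sigma> ''L'' (int x) = L x)"

definition holds :: "(nat \<Rightarrow> nat) \<Rightarrow> (int \<Rightarrow> int) \<Rightarrow> bool" where
  "holds d f \<longleftrightarrow> (\<forall>i<k. f (int i) = int (d i))"

abbreviation stores :: "string \<Rightarrow> (nat \<Rightarrow> nat) \<Rightarrow> store \<Rightarrow> bool" where
  "stores y d \<sigma> \<equiv> holds d (\<sigma> y)"

lemma tables_agree:
  assumes "tables \<sigma>" "agree_off X \<sigma> \<sigma>'"
    and "X \<inter> {''in'', ''N'', ''P'', ''J'', ''A'', ''B'', ''L''} = {}"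
  shows "tables \<sigma>'"
  using assms by (auto simp: tables_def agree_off_def disjoint_iff)

lemma stores_agree: "stores y d \<sigma> \<Longrightarrow> agree_off X \<sigma> \<sigma>' \<Longrightarrow> y \<notin> X \<Longrightarrow> stores y d \<sigma>'"
  by (simp add: holds_def agree_off_def)

lemma runs_try_board:
  assumes t: "tables \<sigma>" and d: "stores ''D'' d \<sigma>" and R: "stores ''R'' R \<sigma>"
    and xy: "\<sigma> ''x'' 0 = int x" "\<sigma> ''y'' 0 = int y" "x < N" "y < N"
    and Q: "\<And>\<sigma>'. stores ''R'' (if x < R (P x) \<and> can_board d R x y then R(P x := x) else R) \<sigma>' \<Longrightarrow> Q \<sigma>'"
  shows "runs try_board \<sigma> (200 * S ^ 0) Q"
proof (rule runs_straight)
  have P: "P x < k" "P y < k" using P_less xy by auto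
  have v: "\<sigma> ''in'' 2 = int s" "\<sigma> ''A'' (int x) = int (A x)" "\<sigma> ''B'' (int y) = int (B y)"
    "\<sigma> ''P'' (int x) = int (P x)" "\<sigma> ''P'' (int y) = int (P y)"
    "\<sigma> ''L'' (int x) = L x" "\<sigma> ''L'' (int y) = L y"
    using t xy by (auto simp: tables_def)
  have w: "\<sigma> ''R'' (int (P x)) = int (R (P x))" "\<sigma> ''R'' (int (P y)) = int (R (P y))"
    "\<sigma> ''D'' (int (P x)) = int (d (P x))" "\<sigma> ''D'' (int (P y)) = int (d (P y))"
    using d R P by (auto simp: holds_def)
  \<comment> \<open>If \<open>R (P y) > y\<close>, the program may read \<open>L\<close> outside the
    table; the value is then immaterial because the conjunct \<open>R (P y) \<le> y\<close> already
    fails.\<close>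
  have l: "\<sigma> ''L'' (int (R (P y))) = L (R (P y))" if "R (P y) \<le> y"
    using t xy(4) that by (auto simp: tables_def)
  let ?g = "x < R (P x) \<and> can_board d R x y"
  have "result try_board \<sigma> = (if ?g then \<sigma>(''R'' := (\<sigma> ''R'')(int (P x) := int x)) else \<sigma>)"
    using l by (auto simp: try_board_def can_board_def arr_def xy v w of_nat_diff)
  then show "Q (result try_board \<sigma>)"
    using R by (intro Q) (auto simp: holds_def)
qed (use size in \<open>simp_all add: try_board_def\<close>)

lemma writes_try_board [simp]: "writes try_board = {''R''}"
  by (simp add: try_board_def)

text \<open>Entries change during the scan but only decrease, so a pair boardable under the initial
  \<open>R\<^sub>0\<close> is still boardable when its turn comes. This yields the hypothesis of
  \<open>complete_step\<close> with \<open>R\<^sub>0\<close> as the old entries.\<close>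

lemma runs_board_round:
  assumes t: "tables \<sigma>" and d: "stores ''D'' d \<sigma>" and R: "stores ''R'' R\<^sub>0 \<sigma>" and s0: "sound d R\<^sub>0"
  shows "runs (FOR ''x'' (V ''N'') (FOR ''y'' (V ''N'') try_board)) \<sigma> (260 * S ^ 2)
    (\<lambda>\<sigma>'. \<exists>R. stores ''R'' R \<sigma>' \<and> sound d R \<and> (\<forall>i<k. R i \<le> R\<^sub>0 i) \<and>
       (\<forall>x<N. \<forall>y<N. can_board d R\<^sub>0 x y \<longrightarrow> R (P x) \<le> x))"
proof -
  define I where "I m \<sigma>' \<longleftrightarrow> (\<exists>R. stores ''R'' R \<sigma>' \<and> sound d R \<and> (\<forall>i<k. R i \<le> R\<^sub>0 i) \<and>
       (\<forall>x<m. \<forall>y<N. can_board d R\<^sub>0 x y \<longrightarrow> R (P x) \<le> x))" for m \<sigma>'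
  have "runs (FOR ''x'' (V ''N'') (FOR ''y'' (V ''N'') try_board)) \<sigma> ((230 + 30) * S ^ Suc 1) (I N)"
  proof (rule runs_FOR)
    show "I 0 \<sigma>" using R s0 by (auto simp: I_def)
    fix x \<sigma>1 assume x: "x < N" "I x \<sigma>1" "\<sigma>1 ''x'' 0 = int x"
      and ag: "agree_off (insert ''x'' (writes (FOR ''y'' (V ''N'') try_board))) \<sigma> \<sigma>1"
    then obtain R1 where R1: "stores ''R'' R1 \<sigma>1" "sound d R1" "\<forall>i<k. R1 i \<le> R\<^sub>0 i"
       "\<forall>x'<x. \<forall>y<N. can_board d R\<^sub>0 x' y \<longrightarrow> R1 (P x') \<le> x'" by (auto simp: I_def)
    have t1: "tables \<sigma>1" and d1: "stores ''D'' d \<sigma>1"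
      using tables_agree[OF t ag] stores_agree[OF d ag] by simp_all
    define K where "K m \<sigma>' \<longleftrightarrow> (\<exists>R. stores ''R'' R \<sigma>' \<and> sound d R \<and> (\<forall>i<k. R i \<le> R1 i) \<and>
       (\<forall>y<m. can_board d R1 x y \<longrightarrow> R (P x) \<le> x))" for m \<sigma>'
    have "runs (FOR ''y'' (V ''N'') try_board) \<sigma>1 ((200 + 30) * S ^ Suc 0) (K N)"
    proof (rule runs_FOR)
      show "K 0 \<sigma>1" using R1 by (auto simp: K_def)
      fix y \<sigma>2 assume y: "y < N" "K y \<sigma>2" "\<sigma>2 ''y'' 0 = int y"
        and ag2: "agree_off (insert ''y'' (writes try_board)) \<sigma>1 \<sigma>2"
      then obtain R2 where R2: "stores ''R'' R2 \<sigma>2" "sound d R2" "\<forall>i<k. R2 i \<le> R1 i"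
         "\<forall>y'<y. can_board d R1 x y' \<longrightarrow> R2 (P x) \<le> x" by (auto simp: K_def)
      have t2: "tables \<sigma>2" and d2: "stores ''D'' d \<sigma>2" and x2: "\<sigma>2 ''x'' 0 = int x"
        using tables_agree[OF t1 ag2] stores_agree[OF d1 ag2] agree_offD[OF ag2] x(3) by simp_all
      have mono: "can_board d R2 x y" if "can_board d R1 x y"
        using can_board_antimono[OF _ _ R2(3) that y(1)] R1(2) R2(2) by (simp add: sound_def)
      show "runs try_board \<sigma>2 (200 * S ^ 0) (K (Suc y))"
      proof (rule runs_try_board[OF t2 d2 R2(1) x2 y(3) x(1) y(1)])
        let ?R = "if x < R2 (P x) \<and> can_board d R2 x y then R2(P x := x) else R2"
        fix \<sigma>3 assume "stores ''R'' ?R \<sigma>3"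
        moreover have "sound d ?R"
          using R2(2) sound_update[OF R2(2) _ _ y(1) x(1)] by simp
        moreover have "\<forall>i<k. ?R i \<le> R1 i"
          using R2(3) by (auto intro: less_imp_le less_le_trans)
        moreover have "\<forall>y'<Suc y. can_board d R1 x y' \<longrightarrow> ?R (P x) \<le> x"
          using R2(4) mono by (auto simp: less_Suc_eq)
        ultimately show "K (Suc y) \<sigma>3" unfolding K_def by blast
      qed
    qed (use size t1 in \<open>auto simp: K_def tables_def agree_offD\<close>)
    then show "runs (FOR ''y'' (V ''N'') try_board) \<sigma>1 (230 * S ^ 1) (I (Suc x))"
    proof (rule runs_mono)
      fix \<sigma>' assume "K N \<sigma>'"
      then obtain R where R: "stores ''R'' R \<sigma>'" "sound d R" "\<forall>i<k. R i \<le> R1 i"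
        "\<forall>y<N. can_board d R1 x y \<longrightarrow> R (P x) \<le> x" by (auto simp: K_def)
      have "R (P x') \<le> x'" if "x' < Suc x" "y < N" "can_board d R\<^sub>0 x' y" for x' y
      proof (cases "x' = x")
        case True
        have "can_board d R1 x y"
          using can_board_antimono[OF _ _ R1(3) _ that(2)] that(3) True s0 R1(2)
          by (simp add: sound_def)
        then show ?thesis using R(4) that True by auto
      next
        case False
        then have "R1 (P x') \<le> x'" using R1(4) that by auto
        moreover have "R (P x') \<le> R1 (P x')" using R(3) P_less[of x'] that x(1) by auto
        ultimately show ?thesis by simp
      qed
      then show "I (Suc x) \<sigma>'"
        unfolding I_def using R R1(3) by (meson le_trans)
    qed simp
  qed (use size t in \<open>auto simp: I_def tables_def agree_offD\<close>)
  then show ?thesis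
    by (rule runs_mono) (auto simp: I_def numeral_2_eq_2)
qed

lemma runs_board_all:
  assumes t: "tables \<sigma>" and d: "stores ''D'' d \<sigma>"
  shows "runs board_all \<sigma> (400 * S ^ 3)
    (\<lambda>\<sigma>'. \<exists>R. stores ''R'' R \<sigma>' \<and> sound d R \<and> complete k d R)"
proof -
  let ?round = "FOR ''x'' (V ''N'') (FOR ''y'' (V ''N'') try_board)"
  define I where "I m \<sigma>' \<longleftrightarrow> (\<forall>i<m. \<sigma>' ''R'' (int i) = int N)" for m and \<sigma>' :: store
  define K where "K m \<sigma>' \<longleftrightarrow> (\<exists>R. stores ''R'' R \<sigma>' \<and> sound d R \<and> complete m d R)" for m \<sigma>'
  have init: "runs (FOR ''i'' (Inp 5) (Write ''R'' (V ''i'') (V ''N''))) \<sigma> ((10 + 30) * S ^ Suc 0) (I k)"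
  proof (rule runs_FOR)
    fix m \<sigma>' assume "m < k" "I m \<sigma>'" "\<sigma>' ''i'' 0 = int m"
      "agree_off (insert ''i'' (writes (Write ''R'' (V ''i'') (V ''N'')))) \<sigma> \<sigma>'"
    then show "runs (Write ''R'' (V ''i'') (V ''N'')) \<sigma>' (10 * S ^ 0) (I (Suc m))"
      using size t by (intro runs_straight) (auto simp: I_def tables_def agree_offD less_Suc_eq)
  qed (use size t in \<open>auto simp: I_def tables_def agree_offD\<close>)
  have rounds: "runs (FOR ''r'' (Inp 5) ?round) \<sigma>' ((260 + 30) * S ^ Suc 2) (K k)"
    if "I k \<sigma>'" and ag: "agree_off (writes (FOR ''i'' (Inp 5) (Write ''R'' (V ''i'') (V ''N'')))) \<sigma> \<sigma>'" for \<sigma>'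
  proof (rule runs_FOR)
    have t': "tables \<sigma>'" and d': "stores ''D'' d \<sigma>'"
      using tables_agree[OF t ag] stores_agree[OF d ag] by simp_all
    show "K 0 \<sigma>'"
      using that(1) sound_init[of "\<lambda>_. N" d] complete_init[of d "\<lambda>_. N"]
      unfolding K_def I_def holds_def by (intro exI[of _ "\<lambda>_. N"]) auto
    show "aval (Inp 5) \<sigma>2 = int k" if "agree_off (insert ''r'' (writes ?round)) \<sigma>' \<sigma>2" for \<sigma>2
      using t' agree_offD[OF that] by (simp add: tables_def)
    fix m \<sigma>1 assume "m < k" "K m \<sigma>1" and ag1: "agree_off (insert ''r'' (writes ?round)) \<sigma>' \<sigma>1"
    then obtain R where R: "stores ''R'' R \<sigma>1" "sound d R" "complete m d R" by (auto simp: K_def)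
    have t1: "tables \<sigma>1" and d1: "stores ''D'' d \<sigma>1"
      using tables_agree[OF t' ag1] stores_agree[OF d' ag1] by simp_all
    show "runs ?round \<sigma>1 (260 * S ^ 2) (K (Suc m))"
    proof (rule runs_mono[OF runs_board_round[OF t1 d1 R(1,2)]])
      fix \<sigma>2 assume "\<exists>R'. stores ''R'' R' \<sigma>2 \<and> sound d R' \<and> (\<forall>i<k. R' i \<le> R i) \<and>
       (\<forall>x<N. \<forall>y<N. can_board d R x y \<longrightarrow> R' (P x) \<le> x)"
      then obtain R' where R': "stores ''R'' R' \<sigma>2" "sound d R'" "\<forall>i<k. R' i \<le> R i"
       "\<forall>x<N. \<forall>y<N. can_board d R x y \<longrightarrow> R' (P x) \<le> x" by blast
      have "complete (Suc m) d R'"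
        using R(2) R'(4) by (intro complete_step[OF R(3) _ R'(3)]) (auto simp: sound_def)
      then show "K (Suc m) \<sigma>2" using R' unfolding K_def by blast
    qed simp
  qed (use size in \<open>auto simp: K_def\<close>)
  have "runs board_all \<sigma> (40 * S ^ 1 + 290 * S ^ 3) (K k)"
    unfolding board_all_def by (rule runs_Seq[where ?Q1.0 = "I k"]) (use init rounds in simp_all)
  moreover have "S ^ 1 \<le> S ^ 3"
    using size(1) by (intro power_increasing) auto
  then have "40 * S ^ 1 + 290 * S ^ 3 \<le> 400 * S ^ 3"
    by linarith
  ultimately show ?thesis
    by (rule runs_mono) (simp add: K_def)
qed

lemma boarded_less: "v \<in> boarded R \<Longrightarrow> v < n"
  using coherent E_arc verts wf_digraph.head_in_verts[of "underlying G"]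
  unfolding boarded_def B_def coherent_def fin_digraph_def by blast

lemma runs_count_boarded:
  assumes t: "tables \<sigma>" and R: "stores ''R'' R \<sigma>"
  shows "runs count_boarded \<sigma> (300 * S ^ 3) (\<lambda>\<sigma>'. \<sigma>' ''c'' 0 = int (card (boarded R)))"
proof -
  define I where "I m \<sigma>' \<longleftrightarrow> \<sigma>' ''c'' 0 = int (card {v \<in> boarded R. v < m})" for m and \<sigma>' :: store
  let ?test = "IF (Conj (Le (Read ''R'' (At ''P'' ''y'')) (V ''y''))
      (Conj (Eq (At ''B'' ''y'') (V ''v'')) (Neg (Eq (V ''v'') (Inp 2))))) (Set ''f'' (Const 1)) SKIP"
  let ?find = "Seq (Set ''f'' (Const 0)) (FOR ''y'' (V ''N'') ?test)"
  let ?body = "Seq ?find (Set ''c'' (Plus (V ''c'') (V ''f'')))"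
  have find: "runs ?find \<sigma>1 (200 * S ^ 1) (\<lambda>\<sigma>'. \<sigma>' ''f'' 0 = (if v \<in> boarded R then 1 else 0))"
    if t1: "tables \<sigma>1" and R1: "stores ''R'' R \<sigma>1" and v: "\<sigma>1 ''v'' 0 = int v" for \<sigma>1 v
  proof -
    define K where "K m \<sigma>' \<longleftrightarrow>
      \<sigma>' ''f'' 0 = (if \<exists>y<m. R (P y) \<le> y \<and> B y = v \<and> v \<noteq> s then 1 else 0)" for m and \<sigma>' :: store
    have a: "runs (Set ''f'' (Const 0)) \<sigma>1 (10 * S ^ 1) (K 0)"
      using size by (intro runs_straight) (auto simp: K_def)
    have "runs (FOR ''y'' (V ''N'') ?test) \<sigma>2 ((60 + 30) * S ^ Suc 0) (K N)"
      if "K 0 \<sigma>2" and ag2: "agree_off (writes (Set ''f'' (Const 0))) \<sigma>1 \<sigma>2" for \<sigma>2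
    proof (rule runs_FOR)
      have t2: "tables \<sigma>2" and R2: "stores ''R'' R \<sigma>2" and v2: "\<sigma>2 ''v'' 0 = int v"
        using tables_agree[OF t1 ag2] stores_agree[OF R1 ag2] agree_offD[OF ag2] v by simp_all
      show "K 0 \<sigma>2" by fact
      show "aval (V ''N'') \<sigma>3 = int N" if "agree_off (insert ''y'' (writes ?test)) \<sigma>2 \<sigma>3" for \<sigma>3
        using t2 agree_offD[OF that] by (simp add: tables_def)
      fix m \<sigma>3 assume m: "m < N" "K m \<sigma>3" "\<sigma>3 ''y'' 0 = int m"
        and ag3: "agree_off (insert ''y'' (writes ?test)) \<sigma>2 \<sigma>3"
      have t3: "tables \<sigma>3" and R3: "stores ''R'' R \<sigma>3" and v3: "\<sigma>3 ''v'' 0 = int v"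
        using tables_agree[OF t2 ag3] stores_agree[OF R2 ag3] agree_offD[OF ag3] v2 by simp_all
      have w: "\<sigma>3 ''P'' (int m) = int (P m)" "\<sigma>3 ''B'' (int m) = int (B m)" "\<sigma>3 ''in'' 2 = int s"
        "\<sigma>3 ''R'' (int (P m)) = int (R (P m))"
        using t3 R3 m(1) P_less[OF m(1)] by (auto simp: tables_def holds_def)
      show "runs ?test \<sigma>3 (60 * S ^ 0) (K (Suc m))"
        using size m(2) by (intro runs_straight) (auto simp: K_def less_Suc_eq m(3) v3 w)
    qed (use size in \<open>auto simp: K_def\<close>)
    note loop = this
    have "runs ?find \<sigma>1 ((10 + 90) * S ^ 1) (K N)"
      by (rule runs_pow_Seq[OF a]) (use loop in simp)
    then show ?thesis
      by (rule runs_mono) (auto simp: K_def boarded_def)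
  qed
  have c0: "runs (Set ''c'' (Const 0)) \<sigma> (10 * S ^ 2) (I 0)"
    using size by (intro runs_straight) (auto simp: I_def)
  have loop: "runs (FOR ''v'' (Inp 3) ?body) \<sigma>1 ((210 + 30) * S ^ Suc 1) (I n)"
    if "I 0 \<sigma>1" and ag1: "agree_off (writes (Set ''c'' (Const 0))) \<sigma> \<sigma>1" for \<sigma>1
  proof (rule runs_FOR)
    have t1: "tables \<sigma>1" and R1: "stores ''R'' R \<sigma>1"
      using tables_agree[OF t ag1] stores_agree[OF R ag1] by simp_all
    show "I 0 \<sigma>1" by fact
    show "aval (Inp 3) \<sigma>3 = int n" if "agree_off (insert ''v'' (writes ?body)) \<sigma>1 \<sigma>3" for \<sigma>3
      using t1 agree_offD[OF that] by (simp add: tables_def)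
    fix m \<sigma>2 assume m: "m < n" "I m \<sigma>2" "\<sigma>2 ''v'' 0 = int m"
      and ag2: "agree_off (insert ''v'' (writes ?body)) \<sigma>1 \<sigma>2"
    have t2: "tables \<sigma>2" and R2: "stores ''R'' R \<sigma>2"
      using tables_agree[OF t1 ag2] stores_agree[OF R1 ag2] by simp_all
    have set: "{v \<in> boarded R. v < Suc m} =
        (if m \<in> boarded R then insert m {v \<in> boarded R. v < m} else {v \<in> boarded R. v < m})"
      by (auto simp: less_Suc_eq)
    have "runs ?body \<sigma>2 ((200 + 10) * S ^ 1) (I (Suc m))"
    proof (rule runs_pow_Seq[OF find[OF t2 R2 m(3)]])
      fix \<sigma>3 assume f: "\<sigma>3 ''f'' 0 = (if m \<in> boarded R then 1 else 0)" and ag3: "agree_off (writes ?find) \<sigma>2 \<sigma>3"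
      have "\<sigma>3 ''c'' 0 = int (card {v \<in> boarded R. v < m})"
        using agree_offD[OF ag3, of "''c''"] m(2) by (simp add: I_def)
      then show "runs (Set ''c'' (Plus (V ''c'') (V ''f''))) \<sigma>3 (10 * S ^ 1) (I (Suc m))"
        using size f finite_boarded[of R] unfolding I_def set
        by (intro runs_straight) (auto simp: card_insert_if)
    qed
    then show "runs ?body \<sigma>2 (210 * S ^ 1) (I (Suc m))" by simp
  qed (use size in \<open>auto simp: I_def\<close>)
  have "runs count_boarded \<sigma> ((10 + 240) * S ^ 2) (I n)"
    unfolding count_boarded_def by (rule runs_pow_Seq[OF c0]) (use loop in \<open>simp add: numeral_2_eq_2\<close>)
  moreover have "{v \<in> boarded R. v < n} = boarded R"
    using boarded_less by auto
  ultimately show ?thesis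
    using size by (elim runs_pow_mono) (auto simp: I_def)
qed

lemma runs_sum_delays:
  assumes t: "tables \<sigma>" and d: "stores ''D'' d \<sigma>"
  shows "runs sum_delays \<sigma> (300 * S ^ 3) (\<lambda>\<sigma>'. \<sigma>' ''u'' 0 = int (\<Sum>i<k. d i))"
proof -
  define I where "I m \<sigma>' \<longleftrightarrow> \<sigma>' ''u'' 0 = int (\<Sum>i<m. d i)" for m and \<sigma>' :: store
  let ?body = "Set ''u'' (Plus (V ''u'') (At ''D'' ''i''))"
  have u0: "runs (Set ''u'' (Const 0)) \<sigma> (10 * S ^ 1) (I 0)"
    using size by (intro runs_straight) (auto simp: I_def)
  have loop: "runs (FOR ''i'' (Inp 5) ?body) \<sigma>1 ((20 + 30) * S ^ Suc 0) (I k)"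
    if "I 0 \<sigma>1" and ag1: "agree_off (writes (Set ''u'' (Const 0))) \<sigma> \<sigma>1" for \<sigma>1
  proof (rule runs_FOR)
    have t1: "tables \<sigma>1" and d1: "stores ''D'' d \<sigma>1"
      using tables_agree[OF t ag1] stores_agree[OF d ag1] by simp_all
    show "I 0 \<sigma>1" by fact
    show "aval (Inp 5) \<sigma>3 = int k" if "agree_off (insert ''i'' (writes ?body)) \<sigma>1 \<sigma>3" for \<sigma>3
      using t1 agree_offD[OF that] by (simp add: tables_def)
    fix m \<sigma>2 assume m: "m < k" "I m \<sigma>2" "\<sigma>2 ''i'' 0 = int m"
      and ag2: "agree_off (insert ''i'' (writes ?body)) \<sigma>1 \<sigma>2"
    have d2: "\<sigma>2 ''D'' (int m) = int (d m)"
      using stores_agree[OF d1 ag2] m(1) by (simp add: holds_def)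
    show "runs ?body \<sigma>2 (20 * S ^ 0) (I (Suc m))"
      using size m d2 by (intro runs_straight) (auto simp: I_def)
  qed (use size in \<open>auto simp: I_def\<close>)
  have "runs sum_delays \<sigma> ((10 + 50) * S ^ 1) (I k)"
    unfolding sum_delays_def by (rule runs_pow_Seq[OF u0]) (use loop in simp)
  then show ?thesis
    using size by (elim runs_pow_mono) (auto simp: I_def)
qed

end

lemma delays_encode_append: "delays_encode (xs @ ys) = delays_encode xs @ delays_encode ys"
  by (simp add: delays_encode_def)

context mrdp_machine
begin

lemma delay_ops_Suc: "delay_ops d R (Suc m) =
    delay_ops d R m @ (if R m < N \<and> 0 < d m then [(m, J (R m), int (d m))] else [])"
  by (simp add: delay_ops_def)

lemma runs_record_best:
  assumes t: "tables \<sigma>" and d: "stores ''D'' d \<sigma>" and R: "stores ''R'' R \<sigma>"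
    and c: "\<sigma> ''c'' 0 = int (card (boarded R))" and u: "\<sigma> ''u'' 0 = int (\<Sum>i<k. d i)"
    and best: "\<sigma> ''t'' 0 = int best"
  shows "runs record_best \<sigma> (300 * S ^ 3) (\<lambda>\<sigma>'.
    if (\<Sum>i<k. d i) \<le> b \<and> best < card (boarded R)
    then \<sigma>' ''t'' 0 = int (card (boarded R)) \<and> output_word \<sigma>' (delays_encode (delay_ops d R k))
    else \<sigma>' ''t'' 0 = int best \<and> \<sigma>' ''out'' = \<sigma> ''out'')"
    (is "runs _ _ _ ?Q")
proof -
  let ?init = "Seq (Set ''t'' (V ''c'')) (Set ''w'' (Const 0))"
  let ?enc = "\<lambda>m. delays_encode (delay_ops d R m)"
  define I where "I m \<sigma>' \<longleftrightarrow> \<sigma>' ''w'' 0 = int (length (?enc m)) \<and>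
    (\<forall>i<length (?enc m). \<sigma>' ''out'' (int i + 1) = ?enc m ! i)" for m and \<sigma>' :: store
  have enc0: "?enc 0 = []" by (simp add: delay_ops_def delays_encode_def)
  have init: "runs ?init \<sigma> (20 * S ^ 1) (\<lambda>\<sigma>'. I 0 \<sigma>' \<and> \<sigma>' ''t'' 0 = int (card (boarded R)))"
    using size by (intro runs_straight) (auto simp: I_def c enc0)
  have emit: "runs (FOR ''i'' (Inp 5) emit_op) \<sigma>1 ((100 + 30) * S ^ Suc 0) (I k)"
    if "I 0 \<sigma>1" and ag1: "agree_off (writes ?init) \<sigma> \<sigma>1" for \<sigma>1
  proof (rule runs_FOR)
    have t1: "tables \<sigma>1" and d1: "stores ''D'' d \<sigma>1" and R1: "stores ''R'' R \<sigma>1"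
      using tables_agree[OF t ag1] stores_agree[OF d ag1] stores_agree[OF R ag1] by simp_all
    show "I 0 \<sigma>1" by fact
    show "aval (Inp 5) \<sigma>3 = int k" if "agree_off (insert ''i'' (writes emit_op)) \<sigma>1 \<sigma>3" for \<sigma>3
      using t1 agree_offD[OF that] by (simp add: tables_def emit_op_def)
    fix m \<sigma>2 assume m: "m < k" "I m \<sigma>2" "\<sigma>2 ''i'' 0 = int m"
      and ag2: "agree_off (insert ''i'' (writes emit_op)) \<sigma>1 \<sigma>2"
    have t2: "tables \<sigma>2" and "stores ''D'' d \<sigma>2" "stores ''R'' R \<sigma>2"
      using tables_agree[OF t1 ag2] stores_agree[OF d1 ag2] stores_agree[OF R1 ag2]
      by (simp_all add: emit_op_def)
    then have v: "\<sigma>2 ''D'' (int m) = int (d m)" "\<sigma>2 ''R'' (int m) = int (R m)" "\<sigma>2 ''N'' 0 = int N"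
      using m(1) by (simp_all add: holds_def tables_def)
    have J: "\<sigma>2 ''J'' (int (R m)) = int (J (R m))" if "R m < N"
      using t2 that by (simp add: tables_def)
    show "runs emit_op \<sigma>2 (100 * S ^ 0) (I (Suc m))"
    proof (rule runs_straight)
      show "I (Suc m) (result emit_op \<sigma>2)"
      proof (cases "R m < N \<and> 0 < d m")
        case True
        let ?w = "\<sigma>2 ''w'' 0"
        have w: "?w = int (length (?enc m))" using m(2) by (simp add: I_def)
        have enc: "?enc (Suc m) = ?enc m @ [int m, int (J (R m)), int (d m)]"
          using True by (simp add: delay_ops_Suc delays_encode_append) (simp add: delays_encode_def)
        have out: "result emit_op \<sigma>2 ''out'' =
            (\<sigma>2 ''out'')(?w + 1 := int m, ?w + 2 := int (J (R m)), ?w + 3 := int (d m))"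
          and w': "result emit_op \<sigma>2 ''w'' 0 = ?w + 3"
          using True J by (simp_all add: emit_op_def v m(3))
        have "result emit_op \<sigma>2 ''out'' (int i + 1) = ?enc (Suc m) ! i" if i: "i < length (?enc (Suc m))" for i
        proof -
          consider "i < length (?enc m)" | "i = length (?enc m)" | "i = length (?enc m) + 1"
            | "i = length (?enc m) + 2"
            using i unfolding enc length_append by fastforce
          then show ?thesis
            using m(2) unfolding out enc w I_def by cases (auto simp: nth_append)
        qed
        then show ?thesis
          unfolding I_def w' w using enc by simp
      next
        case False
        then have "?enc (Suc m) = ?enc m" "result emit_op \<sigma>2 = \<sigma>2"
          by (auto simp: delay_ops_Suc emit_op_def v m(3))
        then show ?thesis using m(2) by (simp add: I_def)
      qed
    qed (use size in \<open>simp_all add: emit_op_def\<close>)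
  qed (use size in \<open>auto simp: I_def emit_op_def\<close>)
  let ?good = "\<lambda>\<sigma>'. \<sigma>' ''t'' 0 = int (card (boarded R)) \<and> output_word \<sigma>' (?enc k)"
  have rest: "runs (Seq (FOR ''i'' (Inp 5) emit_op) (Write ''out'' (Const 0) (V ''w''))) \<sigma>1
      ((130 + 10) * S ^ 1) ?good"
    if I0: "I 0 \<sigma>1 \<and> \<sigma>1 ''t'' 0 = int (card (boarded R))" and ag1: "agree_off (writes ?init) \<sigma> \<sigma>1" for \<sigma>1
  proof (rule runs_pow_Seq[where ?Q1.0 = "I k"])
    show "runs (FOR ''i'' (Inp 5) emit_op) \<sigma>1 (130 * S ^ 1) (I k)"
      using emit[OF _ ag1] I0 by simp
    fix \<sigma>2 assume "I k \<sigma>2" and ag2: "agree_off (writes (FOR ''i'' (Inp 5) emit_op)) \<sigma>1 \<sigma>2"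
    moreover have "\<sigma>2 ''t'' = \<sigma>1 ''t''"
      using agree_offD[OF ag2] by (simp add: emit_op_def)
    ultimately show "runs (Write ''out'' (Const 0) (V ''w'')) \<sigma>2 (10 * S ^ 1) ?good"
      using size I0 by (intro runs_straight) (auto simp: I_def output_word_def)
  qed
  have body: "runs (Seq ?init (Seq (FOR ''i'' (Inp 5) emit_op) (Write ''out'' (Const 0) (V ''w''))))
      \<sigma> ((20 + 140) * S ^ 1) ?good"
    by (rule runs_pow_Seq[OF init]) (use rest in simp)
  have "runs record_best \<sigma> (btime (Conj (Le (V ''u'') (Inp 1)) (Less (V ''t'') (V ''c''))) + 160 * S ^ 1 + 1) ?Q"
    unfolding record_best_def
  proof (rule runs_IF)
    have g: "bval (Conj (Le (V ''u'') (Inp 1)) (Less (V ''t'') (V ''c''))) \<sigma> \<longleftrightarrow>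
        (\<Sum>i<k. d i) \<le> b \<and> best < card (boarded R)"
      using t by (simp add: tables_def u c best flip: of_nat_sum) linarith
    show "runs (Seq ?init (Seq (FOR ''i'' (Inp 5) emit_op) (Write ''out'' (Const 0) (V ''w''))))
      \<sigma> (160 * S ^ 1) ?Q" if "bval (Conj (Le (V ''u'') (Inp 1)) (Less (V ''t'') (V ''c''))) \<sigma>"
      using body that unfolding g by (elim runs_mono) auto
    show "runs SKIP \<sigma> (160 * S ^ 1) ?Q" if "\<not> bval (Conj (Le (V ''u'') (Inp 1)) (Less (V ''t'') (V ''c''))) \<sigma>"
      using that best size unfolding g by (intro runs_straight) auto
  qed
  moreover have "S ^ 1 \<le> S ^ 3" "1 \<le> S ^ 3"
    using size(1) power_increasing[of 1 3 S] by simp_all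
  then have "btime (Conj (Le (V ''u'') (Inp 1)) (Less (V ''t'') (V ''c''))) + 160 * S ^ 1 + 1 \<le> 300 * S ^ 3"
    by simp
  ultimately show ?thesis
    by (rule runs_mono)
qed

text \<open>The \<open>r\<close>-th delay vector lists the digits of \<open>r\<close> in base \<open>b + 1\<close>.\<close>

definition digit :: "nat \<Rightarrow> nat \<Rightarrow> nat" where
  "digit r i = r div Suc b ^ i mod Suc b"

text \<open>\<open>Suc b ^ i dvd Suc r\<close> expresses that the carry reaches position
  \<open>i\<close>, that is, all lower digits of \<open>r\<close> equal \<open>b\<close>.\<close>

lemma digit_Suc:
  "digit (Suc r) i = (if Suc b ^ i dvd Suc r
     then if digit r i < b then Suc (digit r i) else 0 else digit r i)"
proof (cases "Suc b ^ i dvd Suc r")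
  case True
  then have "Suc r div Suc b ^ i = Suc (r div Suc b ^ i)"
    by (simp add: div_Suc dvd_eq_mod_eq_0)
  moreover have "r div Suc b ^ i mod Suc b = b \<or> r div Suc b ^ i mod Suc b < b"
    using mod_less_divisor[of "Suc b" "r div Suc b ^ i"] by linarith
  ultimately show ?thesis
    using True mod_Suc[of "r div Suc b ^ i" "Suc b"] by (auto simp: digit_def)
next
  case False
  then have "Suc r div Suc b ^ i = r div Suc b ^ i"
    by (simp add: div_Suc dvd_eq_mod_eq_0)
  then show ?thesis using False by (simp add: digit_def)
qed

text \<open>Justifies the flag \<open>a\<close> of \<open>next_delays\<close>: it stays set past
  position \<open>i\<close> only if the digit there wraps around from \<open>b\<close> to 0.\<close>

lemma dvd_digit_Suc:
  "Suc b ^ Suc i dvd Suc r \<longleftrightarrow> Suc b ^ i dvd Suc r \<and> \<not> digit r i < b"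
proof (cases "Suc b ^ i dvd Suc r")
  case True
  then obtain q where q: "Suc r = Suc b ^ i * q" by (rule dvdE)
  have "Suc b ^ Suc i dvd Suc r \<longleftrightarrow> Suc b ^ i * Suc b dvd Suc b ^ i * q"
    by (simp only: q power_Suc2)
  also have "\<dots> \<longleftrightarrow> Suc b dvd q"
    by (rule dvd_times_left_cancel_iff) simp
  also have "\<dots> \<longleftrightarrow> digit (Suc r) i = 0"
    unfolding digit_def q by (simp add: dvd_eq_mod_eq_0)
  finally show ?thesis using digit_Suc[of r i] True by auto
next
  case False
  moreover have "Suc b ^ i dvd Suc b ^ Suc i" by (rule le_imp_power_dvd) simp
  ultimately show ?thesis using dvd_trans by blast
qed

lemma digits_surj:
  assumes "\<And>i. i < k' \<Longrightarrow> d i \<le> b"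
  shows "\<exists>r<Suc b ^ k'. \<forall>i<k'. digit r i = d i"
  using assms
proof (induction k')
  case (Suc k')
  then obtain r where r: "r < Suc b ^ k'" "\<forall>i<k'. digit r i = d i" by fastforce
  let ?r = "r + Suc b ^ k' * d k'"
  have "Suc b ^ k' * d k' \<le> Suc b ^ k' * b" using Suc.prems by simp
  then have "?r < Suc b ^ k' + Suc b ^ k' * b"
    using r(1) by linarith
  also have "\<dots> = Suc b ^ Suc k'"
    by (simp add: algebra_simps)
  finally have "?r < Suc b ^ Suc k'" .
  moreover have "digit ?r i = d i" if "i < Suc k'" for i
  proof (cases "i = k'")
    case True
    then show ?thesis using r(1) Suc.prems[of k'] by (simp add: digit_def)
  next
    case False
    then have "i < k'" using that by simp
    \<comment> \<open>The new top digit contributes a multiple of \<open>Suc b ^ Suc i\<close>, so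
      it vanishes from digit \<open>i\<close>.\<close>
    then have "Suc b ^ k' = Suc b ^ i * (Suc b * Suc b ^ (k' - Suc i))"
      by (simp flip: power_Suc power_add)
    then have "?r div Suc b ^ i = r div Suc b ^ i + Suc b * (Suc b ^ (k' - Suc i) * d k')"
      by (simp add: mult.assoc add_mult_distrib)
    then have "digit ?r i = digit r i"
      unfolding digit_def by (simp only: mod_mult_self2)
    then show ?thesis using r(2) \<open>i < k'\<close> by simp
  qed
  ultimately show ?case by blast
qed simp

lemma runs_next_delays:
  assumes t: "tables \<sigma>" and d: "stores ''D'' (digit r) \<sigma>" and r: "r < Suc b ^ k"
  shows "runs next_delays \<sigma> (300 * S ^ 3)
    (\<lambda>\<sigma>'. stores ''D'' (digit (Suc r)) \<sigma>' \<and> \<sigma>' ''z'' 0 = (if Suc r < Suc b ^ k then 0 else 1))"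
proof -
  let ?body = "IF (Less (Const 0) (V ''a''))
            (IF (Less (At ''D'' ''i'') (Inp 1))
              (Seq (Write ''D'' (V ''i'') (Plus (At ''D'' ''i'') (Const 1))) (Set ''a'' (Const 0)))
              (Write ''D'' (V ''i'') (Const 0)))
            SKIP"
  define I where "I m \<sigma>' \<longleftrightarrow> \<sigma>' ''a'' 0 = (if Suc b ^ m dvd Suc r then 1 else 0) \<and>
      (\<forall>i<k. \<sigma>' ''D'' (int i) = int (digit (if i < m then Suc r else r) i))" for m and \<sigma>' :: store
  have init: "runs (Set ''a'' (Const 1)) \<sigma> (10 * S ^ 1) (I 0)"
    using size d by (intro runs_straight) (auto simp: I_def holds_def)
  have loop: "runs (FOR ''i'' (Inp 5) ?body) \<sigma>1 ((60 + 30) * S ^ Suc 0) (I k)"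
    if "I 0 \<sigma>1" and ag1: "agree_off (writes (Set ''a'' (Const 1))) \<sigma> \<sigma>1" for \<sigma>1
  proof (rule runs_FOR)
    have t1: "tables \<sigma>1"
      using tables_agree[OF t ag1] by simp
    show "I 0 \<sigma>1" by fact
    show "aval (Inp 5) \<sigma>3 = int k" if "agree_off (insert ''i'' (writes ?body)) \<sigma>1 \<sigma>3" for \<sigma>3
      using t1 agree_offD[OF that] by (simp add: tables_def)
    fix m \<sigma>2 assume m: "m < k" "I m \<sigma>2" "\<sigma>2 ''i'' 0 = int m"
      and ag2: "agree_off (insert ''i'' (writes ?body)) \<sigma>1 \<sigma>2"
    have t2: "\<sigma>2 ''in'' 1 = int b"
      using tables_agree[OF t1 ag2] by (simp add: tables_def)
    have D: "\<sigma>2 ''D'' (int m) = int (digit r m)"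
      "\<And>i. i < k \<Longrightarrow> \<sigma>2 ''D'' (int i) = int (digit (if i < m then Suc r else r) i)"
      and a: "\<sigma>2 ''a'' 0 = (if Suc b ^ m dvd Suc r then 1 else 0)"
      using m by (simp_all add: I_def)
    have dm: "digit (Suc r) m = (if Suc b ^ m dvd Suc r
         then if digit r m < b then Suc (digit r m) else 0 else digit r m)"
      by (rule digit_Suc)
    have new: "result ?body \<sigma>2 ''D'' = (\<sigma>2 ''D'')(int m := int (digit (Suc r) m))"
      unfolding dm by (auto simp: a t2 m(3) D(1))
    have a': "result ?body \<sigma>2 ''a'' 0 = (if Suc b ^ Suc m dvd Suc r then 1 else 0)"
      unfolding dvd_digit_Suc by (auto simp: a t2 m(3) D(1))
    show "runs ?body \<sigma>2 (60 * S ^ 0) (I (Suc m))"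
    proof (rule runs_straight)
      show "I (Suc m) (result ?body \<sigma>2)"
        unfolding I_def new a' using D(2) by (simp add: less_Suc_eq)
    qed (use size in simp_all)
  qed (use size in \<open>auto simp: I_def\<close>)
  let ?Q = "\<lambda>\<sigma>'. stores ''D'' (digit (Suc r)) \<sigma>' \<and> \<sigma>' ''z'' 0 = (if Suc r < Suc b ^ k then 0 else 1)"
  have last: "runs (Set ''z'' (V ''a'')) \<sigma>1 (10 * S ^ 1) ?Q" if "I k \<sigma>1" for \<sigma>1
  proof -
    \<comment> \<open>As \<open>Suc r\<close> is at most \<open>Suc b ^ k\<close>, the carry leaves
      the last digit only in case of equality.\<close>
    have "Suc b ^ k dvd Suc r \<longleftrightarrow> \<not> Suc r < Suc b ^ k"
      using r by (metis Suc_lessI dvd_refl nat_dvd_not_less zero_less_Suc)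
    then show ?thesis
      using size that by (intro runs_straight) (auto simp: I_def holds_def)
  qed
  have rest: "runs (Seq (FOR ''i'' (Inp 5) ?body) (Set ''z'' (V ''a''))) \<sigma>1 ((90 + 10) * S ^ 1) ?Q"
    if "I 0 \<sigma>1" "agree_off (writes (Set ''a'' (Const 1))) \<sigma> \<sigma>1" for \<sigma>1
    by (rule runs_pow_Seq[where ?Q1.0 = "I k"]) (use loop[OF that] last in simp_all)
  have "runs next_delays \<sigma> ((10 + 100) * S ^ 1) ?Q"
    unfolding next_delays_def by (rule runs_pow_Seq[OF init]) (use rest in simp)
  then show ?thesis
    using size by (elim runs_pow_mono) auto
qed

section \<open>Exhaustive search over the delay vectors\<close>

lemma complete_cong:
  assumes "\<And>i. i < k \<Longrightarrow> d i = d' i" "complete m d R"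
  shows "complete m d' R"
proof -
  \<comment> \<open>A digit vector matches a given \<open>d\<close> only below \<open>k\<close>;
    \<open>explained\<close> evaluates \<open>d\<close> only at paths of used edges, hence below
    \<open>k\<close>.\<close>
  have "explained d lam" if "explained d' lam" for lam
    using that assms(1) P_less used_less[of N A B s lam]
    unfolding explained_def first_used_def by metis
  then show ?thesis
    using assms(2) unfolding complete_def by blast
qed

text \<open>\<open>best\<close> counts vertices without the source, hence the \<open>Suc\<close>.
  Only an inequality is kept, since initially \<open>best = 0\<close> while the empty sequence may
  reach more. \<open>R\<close> is quantified because its table is overwritten for the next
  vector.\<close>

definition searched :: "nat \<Rightarrow> store \<Rightarrow> bool" where
  "searched r \<sigma> \<longleftrightarrow> tables \<sigma> \<and> stores ''D'' (digit r) \<sigma> \<and>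
     \<sigma> ''z'' 0 = (if r < Suc b ^ k then 0 else 1) \<and>
     (\<exists>ds best. output_word \<sigma> (delays_encode ds) \<and> mrdp_feasible G b ds \<and>
        \<sigma> ''t'' 0 = int best \<and> Suc best \<le> card (reach_set (apply_delays G ds) s) \<and>
        (\<forall>r'<r. (\<Sum>i<k. digit r' i) \<le> b \<longrightarrow>
           (\<exists>R. complete k (digit r') R \<and> card (boarded R) \<le> best)))"

text \<open>A competitor with vector \<open>d\<close> reaches at most
  \<open>Suc (card (boarded R)) \<le> Suc best\<close> vertices, where \<open>R\<close> is complete
  for the number with digits \<open>d\<close>; the recorded sequence reaches at least
  \<open>Suc best\<close>.\<close>

lemma searched_optimal:
  assumes "searched (Suc b ^ k) \<sigma>"
  shows "\<exists>ds. output_word \<sigma> (delays_encode ds) \<and> mrdp_optimal G b s ds"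
proof -
  obtain ds best where ds: "output_word \<sigma> (delays_encode ds)" "mrdp_feasible G b ds"
      "Suc best \<le> card (reach_set (apply_delays G ds) s)"
    and all: "\<And>r'. r' < Suc b ^ k \<Longrightarrow> (\<Sum>i<k. digit r' i) \<le> b \<Longrightarrow>
           \<exists>R. complete k (digit r') R \<and> card (boarded R) \<le> best"
    using assms unfolding searched_def by blast
  have "card (reach_set (apply_delays G ds') s) \<le> card (reach_set (apply_delays G ds) s)"
    if feas: "mrdp_feasible G b ds'" for ds'
  proof -
    obtain d where d: "\<And>i. i < k \<Longrightarrow> d i \<le> b" "(\<Sum>i<k. d i) \<le> b"
      "\<And>R. complete k d R \<Longrightarrow> card (reach_set (apply_delays G ds') s) \<le> Suc (card (boarded R))"
      using feasible_bound[OF feas] by blast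
    obtain r where r: "r < Suc b ^ k" "\<forall>i<k. digit r i = d i"
      using digits_surj[of k d] d(1) by blast
    then have "(\<Sum>i<k. digit r i) \<le> b" using d(2) by simp
    then obtain R where R: "complete k (digit r) R" "card (boarded R) \<le> best"
      using all r(1) by blast
    have "complete k d R"
      using complete_cong[OF _ R(1)] r(2) by simp
    then show ?thesis using d(3) R(2) ds(3) by fastforce
  qed
  then show ?thesis
    using ds unfolding mrdp_optimal_def by blast
qed

lemma runs_search_step:
  assumes "searched r \<sigma>" "r < Suc b ^ k"
  shows "runs (Seq board_all (Seq count_boarded (Seq sum_delays (Seq record_best next_delays)))) \<sigma>
    (1600 * S ^ 3) (searched (Suc r))"
proof -
  let ?d = "digit r"
  have t: "tables \<sigma>" and D: "stores ''D'' ?d \<sigma>"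
    using assms(1) by (auto simp: searched_def)
  obtain ds best where ds: "output_word \<sigma> (delays_encode ds)" "mrdp_feasible G b ds"
      "\<sigma> ''t'' 0 = int best" "Suc best \<le> card (reach_set (apply_delays G ds) s)"
    and all: "\<And>r'. r' < r \<Longrightarrow> (\<Sum>i<k. digit r' i) \<le> b \<Longrightarrow>
           \<exists>R. complete k (digit r') R \<and> card (boarded R) \<le> best"
    using assms unfolding searched_def by blast
  have "runs (Seq board_all (Seq count_boarded (Seq sum_delays (Seq record_best next_delays)))) \<sigma>
    ((400 + (300 + (300 + (300 + 300)))) * S ^ 3) (searched (Suc r))"
  proof (rule runs_pow_Seq[OF runs_board_all[OF t D]])
    fix \<sigma>1 assume "\<exists>R. stores ''R'' R \<sigma>1 \<and> sound ?d R \<and> complete k ?d R"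
      and ag1: "agree_off (writes board_all) \<sigma> \<sigma>1"
    then obtain R where R1: "stores ''R'' R \<sigma>1" and R: "sound ?d R" "complete k ?d R" by blast
    have t1: "tables \<sigma>1" and D1: "stores ''D'' ?d \<sigma>1"
      and b1: "\<sigma>1 ''out'' = \<sigma> ''out''" "\<sigma>1 ''t'' 0 = int best"
      using tables_agree[OF t ag1] stores_agree[OF D ag1] agree_offD[OF ag1] ds(3)
      by (simp_all add: board_all_def)
    show "runs (Seq count_boarded (Seq sum_delays (Seq record_best next_delays))) \<sigma>1
      ((300 + (300 + (300 + 300))) * S ^ 3) (searched (Suc r))"
    proof (rule runs_pow_Seq[OF runs_count_boarded[OF t1 R1]])
      fix \<sigma>2 assume c2: "\<sigma>2 ''c'' 0 = int (card (boarded R))" and ag2: "agree_off (writes count_boarded) \<sigma>1 \<sigma>2"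
      have t2: "tables \<sigma>2" and D2: "stores ''D'' ?d \<sigma>2" and R2: "stores ''R'' R \<sigma>2"
        and b2: "\<sigma>2 ''out'' = \<sigma> ''out''" "\<sigma>2 ''t'' 0 = int best"
        using tables_agree[OF t1 ag2] stores_agree[OF D1 ag2] stores_agree[OF R1 ag2] agree_offD[OF ag2] b1
        by (simp_all add: count_boarded_def)
      show "runs (Seq sum_delays (Seq record_best next_delays)) \<sigma>2
        ((300 + (300 + 300)) * S ^ 3) (searched (Suc r))"
      proof (rule runs_pow_Seq[OF runs_sum_delays[OF t2 D2]])
        fix \<sigma>3 assume u3: "\<sigma>3 ''u'' 0 = int (\<Sum>i<k. ?d i)" and ag3: "agree_off (writes sum_delays) \<sigma>2 \<sigma>3"
        have t3: "tables \<sigma>3" and D3: "stores ''D'' ?d \<sigma>3" and R3: "stores ''R'' R \<sigma>3"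
          and c3: "\<sigma>3 ''c'' 0 = int (card (boarded R))"
          and b3: "\<sigma>3 ''out'' = \<sigma> ''out''" "\<sigma>3 ''t'' 0 = int best"
          using tables_agree[OF t2 ag3] stores_agree[OF D2 ag3] stores_agree[OF R2 ag3] agree_offD[OF ag3] b2 c2
          by (simp_all add: sum_delays_def)
        let ?better = "(\<Sum>i<k. ?d i) \<le> b \<and> best < card (boarded R)"
        show "runs (Seq record_best next_delays) \<sigma>3 ((300 + 300) * S ^ 3) (searched (Suc r))"
        proof (rule runs_pow_Seq[OF runs_record_best[OF t3 D3 R3 c3 u3 b3(2)]])
          fix \<sigma>4 assume post: "if ?better
            then \<sigma>4 ''t'' 0 = int (card (boarded R)) \<and> output_word \<sigma>4 (delays_encode (delay_ops ?d R k))
            else \<sigma>4 ''t'' 0 = int best \<and> \<sigma>4 ''out'' = \<sigma>3 ''out''"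
            and ag4: "agree_off (writes record_best) \<sigma>3 \<sigma>4"
          have t4: "tables \<sigma>4" and D4: "stores ''D'' ?d \<sigma>4"
            using tables_agree[OF t3 ag4] stores_agree[OF D3 ag4]
            by (simp_all add: record_best_def emit_op_def)
          define best' where "best' = (if ?better then card (boarded R) else best)"
          define ds' where "ds' = (if ?better then delay_ops ?d R k else ds)"
          have ds': "output_word \<sigma>4 (delays_encode ds')" "\<sigma>4 ''t'' 0 = int best'"
            using post ds(1) b3(1) by (auto simp: ds'_def best'_def output_word_def split: if_splits)
          have "mrdp_feasible G b ds' \<and> Suc best' \<le> card (reach_set (apply_delays G ds') s)"
            using sound_feasible[OF R(1), of b] ds(2,4) unfolding ds'_def best'_def by simp
          moreover have "\<exists>R. complete k (digit r') R \<and> card (boarded R) \<le> best'"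
            if r': "r' < Suc r" "(\<Sum>i<k. digit r' i) \<le> b" for r'
          proof (cases "r' = r")
            case True
            then show ?thesis using R(2) r'(2) by (intro exI[of _ R]) (auto simp: best'_def)
          next
            case False
            then obtain R' where "complete k (digit r') R'" "card (boarded R') \<le> best"
              using all[of r'] r' by auto
            moreover have "best \<le> best'" by (simp add: best'_def)
            ultimately show ?thesis by (meson le_trans)
          qed
          ultimately have inv: "mrdp_feasible G b ds'" "Suc best' \<le> card (reach_set (apply_delays G ds') s)"
            "\<forall>r'<Suc r. (\<Sum>i<k. digit r' i) \<le> b \<longrightarrow> (\<exists>R. complete k (digit r') R \<and> card (boarded R) \<le> best')"
            by blast+
          show "runs next_delays \<sigma>4 (300 * S ^ 3) (searched (Suc r))"
          proof (rule runs_mono[OF runs_next_delays[OF t4 D4 assms(2)]])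
            fix \<sigma>5 assume 5: "stores ''D'' (digit (Suc r)) \<sigma>5 \<and> \<sigma>5 ''z'' 0 = (if Suc r < Suc b ^ k then 0 else 1)"
              and ag5: "agree_off (writes next_delays) \<sigma>4 \<sigma>5"
            have t5: "tables \<sigma>5" "\<sigma>5 ''out'' = \<sigma>4 ''out''" "\<sigma>5 ''t'' = \<sigma>4 ''t''"
              using tables_agree[OF t4 ag5] agree_offD[OF ag5] by (simp_all add: next_delays_def)
            have "output_word \<sigma>5 (delays_encode ds')" "\<sigma>5 ''t'' 0 = int best'"
              using ds' t5(2,3) by (simp_all add: output_word_def)
            then show "searched (Suc r) \<sigma>5"
              unfolding searched_def using 5 t5(1) inv by blast
          qed simp
        qed
      qed
    qed
  qed
  then show ?thesis by simp
qed

text \<open>Cell 0 holds the length and cells 1 to 5 the header, so tails start at 6, heads at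
  \<open>6 + m\<close> and paths at \<open>6 + 2 * m\<close>. Path \<open>i\<close> is preceded by
  \<open>i\<close> length cells and by two cells for each of the \<open>off i\<close> earlier
  edges.\<close>

definition encoded :: "(int \<Rightarrow> int) \<Rightarrow> nat \<Rightarrow> bool" where
  "encoded f m \<longleftrightarrow> f 1 = int b \<and> f 2 = int s \<and> f 3 = int n \<and> f 4 = int m \<and> f 5 = int k \<and>
     (\<forall>e<m. f (6 + int e) = int (tail (underlying G) e) \<and>
            f (6 + int m + int e) = int (head (underlying G) e)) \<and>
     (\<forall>i<k. f (int (6 + 2 * m + i + 2 * off i)) = int (length (base_paths G ! i)) \<and>
        (\<forall>j<length (base_paths G ! i).
           f (int (7 + 2 * m + i + 2 * (off i + j))) = int (fst (base_paths G ! i ! j)) \<and>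
           f (int (8 + 2 * m + i + 2 * (off i + j))) = snd (base_paths G ! i ! j)))"

definition filled :: "nat \<Rightarrow> store \<Rightarrow> bool" where
  "filled l \<sigma> \<longleftrightarrow> (\<forall>x<l. \<sigma> ''P'' (int x) = int (P x) \<and> \<sigma> ''J'' (int x) = int (J x) \<and>
     \<sigma> ''A'' (int x) = int (A x) \<and> \<sigma> ''B'' (int x) = int (B x) \<and> \<sigma> ''L'' (int x) = L x)"

lemma runs_parse:
  assumes enc: "encoded (\<sigma> ''in'') m" and arcs: "arcs (underlying G) = {..<m}" and N0: "\<sigma> ''N'' 0 = 0"
  shows "runs parse \<sigma> (300 * S ^ 3) tables"
proof -
  let ?first = "Set ''q'' (Plus (Const 6) (Plus (Inp 4) (Inp 4)))"
  let ?head = "Seq (Set ''l'' (At ''in'' ''q'')) (Set ''q'' (Plus (V ''q'') (Const 1)))"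
  let ?body = "Seq ?head (FOR ''j'' (V ''l'') read_edge)"
  define I where "I i \<sigma>' \<longleftrightarrow> \<sigma>' ''N'' 0 = int (off i) \<and> \<sigma>' ''q'' 0 = int (6 + 2 * m + i + 2 * off i) \<and>
    filled (off i) \<sigma>'" for i and \<sigma>' :: store
  have in4: "\<sigma> ''in'' 4 = int m" using enc by (simp add: encoded_def)
  have first: "runs ?first \<sigma> (20 * S ^ 2) (I 0)"
    using size N0 in4 by (intro runs_straight) (auto simp: I_def filled_def)
  have loop: "runs (FOR ''i'' (Inp 5) ?body) \<sigma>1 ((150 + 30) * S ^ Suc 1) (I k)"
    if "I 0 \<sigma>1" and ag1: "agree_off (writes ?first) \<sigma> \<sigma>1" for \<sigma>1
  proof (rule runs_FOR)
    have in1: "\<sigma>1 ''in'' = \<sigma> ''in''" using agree_offD[OF ag1] by simp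
    show "I 0 \<sigma>1" by fact
    show "aval (Inp 5) \<sigma>3 = int k" if "agree_off (insert ''i'' (writes ?body)) \<sigma>1 \<sigma>3" for \<sigma>3
      using agree_offD[OF that] in1 enc by (simp add: read_edge_def encoded_def)
    fix i \<sigma>2 assume i: "i < k" "I i \<sigma>2" "\<sigma>2 ''i'' 0 = int i"
      and ag2: "agree_off (insert ''i'' (writes ?body)) \<sigma>1 \<sigma>2"
    let ?len = "length (base_paths G ! i)"
    have in2: "\<sigma>2 ''in'' = \<sigma> ''in''" using agree_offD[OF ag2] in1 by (simp add: read_edge_def)
    define K where "K j \<sigma>' \<longleftrightarrow> \<sigma>' ''N'' 0 = int (off i + j) \<and>
      \<sigma>' ''q'' 0 = int (7 + 2 * m + i + 2 * (off i + j)) \<and> filled (off i + j) \<sigma>'" for j and \<sigma>' :: store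
    have len: "\<sigma> ''in'' (int (6 + 2 * m + i + 2 * off i)) = int ?len"
      using enc i(1) by (simp add: encoded_def)
    have head: "runs ?head \<sigma>2 (20 * S ^ 1) (\<lambda>\<sigma>'. K 0 \<sigma>' \<and> \<sigma>' ''l'' 0 = int ?len)"
      using size i(2) len in2 by (intro runs_straight) (auto simp: I_def K_def filled_def)
    have edges: "runs (FOR ''j'' (V ''l'') read_edge) \<sigma>3 ((100 + 30) * S ^ Suc 0) (I (Suc i))"
      if K0: "K 0 \<sigma>3 \<and> \<sigma>3 ''l'' 0 = int ?len" and ag3: "agree_off (writes ?head) \<sigma>2 \<sigma>3" for \<sigma>3
    proof -
      have in3: "\<sigma>3 ''in'' = \<sigma> ''in''" "\<sigma>3 ''i'' 0 = int i"
        using agree_offD[OF ag3] in2 i(3) by simp_all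
      have "runs (FOR ''j'' (V ''l'') read_edge) \<sigma>3 ((100 + 30) * S ^ Suc 0) (K ?len)"
      proof (rule runs_FOR)
        show "K 0 \<sigma>3" using K0 by simp
        show "aval (V ''l'') \<sigma>4 = int ?len" if "agree_off (insert ''j'' (writes read_edge)) \<sigma>3 \<sigma>4" for \<sigma>4
          using agree_offD[OF that] K0 by (simp add: read_edge_def)
        have "?len \<le> N"
          using off_mono[of "Suc i" k] off_Suc[of i] i(1) unfolding N_def by linarith
        then show "?len \<le> S" using size by linarith
        fix j \<sigma>4 assume j: "j < ?len" "K j \<sigma>4" "\<sigma>4 ''j'' 0 = int j"
          and ag4: "agree_off (insert ''j'' (writes read_edge)) \<sigma>3 \<sigma>4"
        have in4': "\<sigma>4 ''in'' = \<sigma> ''in''" "\<sigma>4 ''i'' 0 = int i"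
          using agree_offD[OF ag4] in3 by (simp_all add: read_edge_def)
        let ?x = "off i + j"
        have x: "P ?x = i" "J ?x = j" using P_off J_off j(1) by simp_all
        have xN: "?x < N" using off_less_N i(1) j(1) by simp
        have E: "E ?x = fst (base_paths G ! i ! j)" and L: "L ?x = snd (base_paths G ! i ! j)"
          by (simp_all add: E_def L_def x)
        have Em: "E ?x < m" using E_arc[OF xN] arcs by simp
        have q: "\<sigma>4 ''q'' 0 = int (7 + 2 * m + i + 2 * ?x)" "\<sigma>4 ''N'' 0 = int ?x"
          and fill: "filled ?x \<sigma>4"
          using j(2) unfolding K_def by blast+
        have rd: "\<sigma> ''in'' (\<sigma>4 ''q'' 0) = int (E ?x)" "\<sigma> ''in'' (\<sigma>4 ''q'' 0 + 1) = L ?x"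
        proof -
          have "int (8 + 2 * m + i + 2 * ?x) = \<sigma>4 ''q'' 0 + 1" by (simp add: q)
          then show "\<sigma> ''in'' (\<sigma>4 ''q'' 0) = int (E ?x)" "\<sigma> ''in'' (\<sigma>4 ''q'' 0 + 1) = L ?x"
            using enc i(1) j(1) unfolding encoded_def E L q(1) by metis+
        qed
        have AB: "\<sigma> ''in'' (6 + int (E ?x)) = int (A ?x)" "\<sigma> ''in'' (6 + (int m + int (E ?x))) = int (B ?x)"
          using enc Em by (simp_all add: encoded_def A_def B_def add.assoc)
        show "runs read_edge \<sigma>4 (100 * S ^ 0) (K (Suc j))"
        proof (rule runs_straight)
          define \<sigma>5 where "\<sigma>5 = result read_edge \<sigma>4"
          have r: "\<sigma>5 ''P'' = (\<sigma>4 ''P'')(int ?x := int (P ?x))" "\<sigma>5 ''J'' = (\<sigma>4 ''J'')(int ?x := int (J ?x))"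
            "\<sigma>5 ''A'' = (\<sigma>4 ''A'')(int ?x := int (A ?x))" "\<sigma>5 ''B'' = (\<sigma>4 ''B'')(int ?x := int (B ?x))"
            "\<sigma>5 ''L'' = (\<sigma>4 ''L'')(int ?x := L ?x)"
            "\<sigma>5 ''q'' 0 = \<sigma>4 ''q'' 0 + 2" "\<sigma>5 ''N'' 0 = \<sigma>4 ''N'' 0 + 1"
            unfolding \<sigma>5_def read_edge_def
            using rd AB q(2) in4 x j(3) in4' by simp_all
          have "filled (Suc ?x) \<sigma>5"
            using fill unfolding filled_def r by (auto simp: less_Suc_eq)
          then show "K (Suc j) (result read_edge \<sigma>4)"
            unfolding K_def \<sigma>5_def[symmetric] using r(6,7) q by simp
        qed (use size in \<open>simp_all add: read_edge_def\<close>)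
      qed (use size in \<open>auto simp: K_def filled_def read_edge_def\<close>)
      then show ?thesis
        by (rule runs_mono) (auto simp: K_def I_def off_Suc)
    qed
    have "runs ?body \<sigma>2 ((20 + 130) * S ^ 1) (I (Suc i))"
      by (rule runs_pow_Seq[OF head]) (use edges in simp)
    then show "runs ?body \<sigma>2 (150 * S ^ 1) (I (Suc i))" by simp
  qed (use size in \<open>auto simp: I_def filled_def read_edge_def\<close>)
  have "runs parse \<sigma> ((20 + 180) * S ^ 2) (I k)"
    unfolding parse_def by (rule runs_pow_Seq[OF first]) (use loop in \<open>simp add: numeral_2_eq_2\<close>)
  then show ?thesis
  proof (rule runs_pow_mono)
    fix \<sigma>' assume I: "I k \<sigma>'" and ag: "agree_off (writes parse) \<sigma> \<sigma>'"
    have "\<sigma>' ''in'' = \<sigma> ''in''"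
      using agree_offD[OF ag] by (simp add: parse_def read_edge_def)
    then show "tables \<sigma>'"
      using I enc unfolding tables_def I_def encoded_def N_def[symmetric] filled_def by auto
  qed (use size in auto)
qed

lemma runs_solve:
  assumes enc: "encoded (\<sigma> ''in'') m" and arcs: "arcs (underlying G) = {..<m}"
    and zero: "\<And>x i. x \<noteq> ''in'' \<Longrightarrow> \<sigma> x i = 0"
  shows "runs solve \<sigma> (2000 * (S ^ 3 * Suc b ^ k))
    (\<lambda>\<sigma>'. \<exists>ds. output_word \<sigma>' (delays_encode ds) \<and> mrdp_optimal G b s ds)"
proof -
  let ?g = "Less (V ''z'') (Const 1)"
  have par: "runs parse \<sigma> (300 * S ^ 3) tables"
    by (rule runs_parse[OF _ arcs]) (simp_all add: enc zero)
  have "runs solve \<sigma> (300 * S ^ 3 + (Suc b ^ k * (1600 * S ^ 3 + btime ?g + 1) + btime ?g + 1))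
     (searched (Suc b ^ k))"
    unfolding solve_def
  proof (rule runs_Seq[OF par])
    fix \<sigma>1 assume t: "tables \<sigma>1" and ag: "agree_off (writes parse) \<sigma> \<sigma>1"
    \<comment> \<open>All banks outside the input start at zero, which is already the state of the
      search before the first vector: zero delays, \<open>best = 0\<close> and the empty output
      word.\<close>
    have z: "\<sigma>1 ''D'' i = 0" "\<sigma>1 ''z'' i = 0" "\<sigma>1 ''t'' i = 0" "\<sigma>1 ''out'' i = 0" for i
      using agree_offD[OF ag] zero by (simp_all add: parse_def read_edge_def)
    have "reach_set (apply_delays G []) s = insert s (B ` {x. used N A B s (delayed_label []) x})"
      by (rule reach_set_delayed) simp
    moreover have "finite {x. used N A B s (delayed_label []) x}"
      by (rule finite_subset[of _ "{..<N}"]) (auto dest: used_less)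
    ultimately have "1 \<le> card (reach_set (apply_delays G []) s)"
      by (simp add: card_gt_0_iff Suc_le_eq)
    moreover have "output_word \<sigma>1 (delays_encode [])"
      by (simp add: output_word_def delays_encode_def z)
    ultimately have s0: "searched 0 \<sigma>1"
      unfolding searched_def using t feasible_Nil
      by (auto simp: z holds_def digit_def intro!: exI[of _ "[]"])
    show "runs (WHILE ?g (Seq board_all (Seq count_boarded (Seq sum_delays (Seq record_best next_delays))))) \<sigma>1
      (Suc b ^ k * (1600 * S ^ 3 + btime ?g + 1) + btime ?g + 1) (searched (Suc b ^ k))"
    proof (rule runs_WHILE[where I = searched, OF s0])
      show "bval ?g \<sigma>2 \<and> runs (Seq board_all (Seq count_boarded (Seq sum_delays (Seq record_best next_delays))))
          \<sigma>2 (1600 * S ^ 3) (searched (Suc r))" if "r < Suc b ^ k" "searched r \<sigma>2" for r \<sigma>2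
        using runs_search_step[OF that(2,1)] that by (simp add: searched_def)
    qed (simp_all add: searched_def)
  qed
  \<comment> \<open>As both powers are at least 1, the left side is at most
    \<open>300 + 1600 + 5 + 5\<close> times their product; the bound is rounded up to 2000.\<close>
  moreover have "300 * S ^ 3 + (Suc b ^ k * (1600 * S ^ 3 + btime ?g + 1) + btime ?g + 1)
      \<le> 2000 * (S ^ 3 * Suc b ^ k)"
  proof -
    define p q where "p = S ^ 3" and "q = Suc b ^ k"
    have p: "1 \<le> p" "1 \<le> q" using size(1) by (auto simp: p_def q_def)
    then have "p \<le> p * q" "q \<le> p * q" "1 \<le> p * q"
      by (auto simp: Suc_le_eq)
    moreover have g: "btime ?g = 4"
      by simp
    moreover have "q * (1600 * p + 4 + 1) = 1600 * (p * q) + 5 * q"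
      by (simp add: algebra_simps)
    ultimately show ?thesis
      unfolding p_def[symmetric] q_def[symmetric] g by linarith
  qed
  ultimately show ?thesis
    by (rule runs_mono) (rule searched_optimal)
qed

end

section \<open>Reading the input\<close>

lemma concat_nth_offset:
  assumes "i < length xss" "j < length (xss ! i)"
  shows "(\<Sum>i'<i. length (xss ! i')) + j < length (concat xss)"
    and "concat xss ! ((\<Sum>i'<i. length (xss ! i')) + j) = xss ! i ! j"
  using assms
proof (induction xss arbitrary: i)
  case (Cons xs xss)
  {
    case 1
    then show ?case
      using Cons.IH(1)[of "i - 1"] by (cases i) (auto simp: sum.lessThan_Suc_shift simp del: sum.lessThan_Suc)
  next
    case 2
    then show ?case
      using Cons.IH(2)[of "i - 1"]
      by (cases i) (auto simp: sum.lessThan_Suc_shift nth_append simp del: sum.lessThan_Suc)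
  }
qed simp_all

lemma path_word_nth:
  assumes "j < length p"
  shows "concat (map (\<lambda>(e, t). [int e, t]) p) ! (2 * j) = int (fst (p ! j))"
    and "concat (map (\<lambda>(e, t). [int e, t]) p) ! Suc (2 * j) = snd (p ! j)"
proof -
  let ?w = "map (\<lambda>(e, t). [int e, t]) p"
  have "(\<Sum>i'<j. length (?w ! i')) = (\<Sum>i'<j. 2)"
    using assms by (intro sum.cong) (auto split: prod.split)
  then have s: "(\<Sum>i'<j. length (?w ! i')) = 2 * j" by simp
  show "concat ?w ! (2 * j) = int (fst (p ! j))" "concat ?w ! Suc (2 * j) = snd (p ! j)"
    using concat_nth_offset(2)[of j ?w 0] concat_nth_offset(2)[of j ?w 1] assms
    unfolding s by (auto split: prod.splits)
qed

lemma length_path_word: "length (concat (map (\<lambda>(e, t). [int e, t]) p)) = 2 * length p"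
  by (induction p) auto

lemma input_store_nth: "j < length xs \<Longrightarrow> input_store xs ''in'' (int (Suc j)) = xs ! j"
  by (simp add: input_store_def nat_add_distrib)

lemma (in mrdp_machine) encoded_input:
  assumes x: "G = the_graph x" "s = source x" "b = budget x" and m: "m = card (arcs (underlying G))"
  shows "encoded (input_store (mrdp_encode x) ''in'') m"
proof -
  let ?D = "underlying G"
  let ?f = "\<lambda>p. int (length p) # concat (map (\<lambda>(e, t). [int e, t]) p)"
  let ?hd = "[int b, int s, int n, int m, int k]"
  let ?T = "map (\<lambda>e. int (tail ?D e)) [0..<m]" and ?H = "map (\<lambda>e. int (head ?D e)) [0..<m]"
  let ?C = "concat (map ?f (base_paths G))"
  let ?in = "input_store (mrdp_encode x) ''in''"
  have w: "mrdp_encode x = ?hd @ ?T @ ?H @ ?C"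
    using verts by (simp add: mrdp_encode_def Let_def num_paths_def k_def m flip: x)
  have hd: "?in (int (Suc j)) = ?hd ! j" if "j < 5" for j
  proof -
    have "mrdp_encode x ! j = ?hd ! j"
      unfolding w by (subst nth_append) (use that in simp)
    moreover have "j < length (mrdp_encode x)"
      using that by (simp add: w)
    ultimately show ?thesis
      by (simp only: input_store_nth)
  qed
  have T: "?in (int (6 + e)) = int (tail ?D e)" if "e < m" for e
    using input_store_nth[of "5 + e" "mrdp_encode x"] that by (simp add: w nth_append)
  have H: "?in (int (6 + m + e)) = int (head ?D e)" if "e < m" for e
    using input_store_nth[of "5 + m + e" "mrdp_encode x"] that by (simp add: w nth_append add.assoc)
  have C: "?in (int (6 + 2 * m + j)) = ?C ! j" if "j < length ?C" for j
    using input_store_nth[of "5 + 2 * m + j" "mrdp_encode x"] that unfolding w by (simp add: nth_append add.assoc)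
  have pos: "(\<Sum>i'<i. length (map ?f (base_paths G) ! i')) = i + 2 * off i" if "i < k" for i
  proof -
    have "(\<Sum>i'<i. length (map ?f (base_paths G) ! i')) = (\<Sum>i'<i. 1 + 2 * length (base_paths G ! i'))"
      using that by (intro sum.cong) (auto simp: k_def length_path_word)
    also have "\<dots> = i + 2 * off i"
      unfolding sum.distrib off_def sum_distrib_left by simp
    finally show ?thesis .
  qed
  have path: "?in (int (6 + 2 * m + (i + 2 * off i + j))) = ?f (base_paths G ! i) ! j"
    if "i < k" "j < Suc (2 * length (base_paths G ! i))" for i j
    using concat_nth_offset[of i "map ?f (base_paths G)" j] that C[of "i + 2 * off i + j"]
    unfolding pos[OF that(1)] by (simp add: k_def length_path_word)
  show ?thesis
    unfolding encoded_def
  proof (intro conjI allI impI)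
    show "?in 1 = int b" "?in 2 = int s" "?in 3 = int n" "?in 4 = int m" "?in 5 = int k"
      using hd[of 0] hd[of 1] hd[of 2] hd[of 3] hd[of 4] by simp_all
    show "?in (6 + int e) = int (tail ?D e)" "?in (6 + int m + int e) = int (head ?D e)" if "e < m" for e
      using T[OF that] H[OF that] by simp_all
    fix i assume i: "i < k"
    show "?in (int (6 + 2 * m + i + 2 * off i)) = int (length (base_paths G ! i))"
      using path[OF i, of 0] by (simp add: add.assoc)
    fix j assume j: "j < length (base_paths G ! i)"
    have "7 + 2 * m + i + 2 * (off i + j) = 6 + 2 * m + (i + 2 * off i + Suc (2 * j))"
      "8 + 2 * m + i + 2 * (off i + j) = 6 + 2 * m + (i + 2 * off i + Suc (Suc (2 * j)))"
      by simp_all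
    then show "?in (int (7 + 2 * m + i + 2 * (off i + j))) = int (fst (base_paths G ! i ! j))"
      "?in (int (8 + 2 * m + i + 2 * (off i + j))) = snd (base_paths G ! i ! j)"
      using path[OF i, of "Suc (2 * j)"] path[OF i, of "Suc (Suc (2 * j))"] j path_word_nth[OF j]
      by (simp_all only: nth_Cons_Suc)
  qed
qed

text \<open>The size of the graph serves as \<open>S\<close>. It bounds the number of numbered edges
  because the base-paths partition the multiset of temporal edges, and it is positive because the
  source is a vertex.\<close>

lemma solve_correct:
  assumes "x \<in> mrdp_instances"
  shows "runs solve (input_store (mrdp_encode x))
    (2000 * (graph_size x ^ 3 * Suc (budget x) ^ num_paths x))
    (\<lambda>\<sigma>'. \<exists>ds. output_word \<sigma>' (delays_encode ds) \<and>
       mrdp_optimal (the_graph x) (budget x) (source x) ds)"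
proof -
  define G where "G = the_graph x"
  have kp: "temporal_k_path_graph (num_paths x) G" and src: "source x \<in> verts (underlying G)"
    and ex: "\<exists>n. verts (underlying G) = {..<n}" "\<exists>m. arcs (underlying G) = {..<m}"
    using assms by (auto simp: mrdp_instances_def G_def Let_def)
  obtain n m where nm: "verts (underlying G) = {..<n}" "arcs (underlying G) = {..<m}"
    using ex by blast
  interpret mrdp_graph G "source x"
    using coherentI[OF kp] src by unfold_locales
  have k: "k = num_paths x" unfolding k_def num_paths_def by (simp add: G_def)
  have "size (\<Sum>p\<leftarrow>ps. mset p) = (\<Sum>p\<leftarrow>ps. length p)" for ps :: "(nat \<times> int) list list"
    by (induction ps) auto
  then have "size (temporal_edges G) = (\<Sum>p\<leftarrow>base_paths G. length p)"
    using kp by (simp add: temporal_k_path_graph_def flip: G_def) metis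
  also have "\<dots> = N"
    by (simp add: N_def off_def k_def sum_list_sum_nth atLeast0LessThan)
  finally have "size (temporal_edges G) = N" .
  then have sz: "graph_size x = n + m + N + k"
    by (simp add: graph_size_def path_graph_size_def nm k_def flip: G_def)
  have "1 \<le> n" using src nm by auto
  then interpret mrdp_machine G "source x" "budget x" n "graph_size x"
    using nm(1) sz by unfold_locales auto
  have enc: "encoded (input_store (mrdp_encode x) ''in'') m"
    by (rule encoded_input) (simp_all add: G_def nm flip: G_def)
  show ?thesis
    unfolding k[symmetric] G_def[symmetric]
    by (rule runs_solve[OF _ nm(2)]) (simp_all add: enc, simp add: input_store_def)
qed

text \<open>Combines \<open>Suc b \<le> 2 * max 1 b\<close> with
  \<open>2 ^ k \<le> 2 * k ^ k\<close>, where the outer factor 2 is for \<open>k = 1\<close>. The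
  maximum keeps the bound positive for \<open>b = 0\<close>.\<close>

lemma Suc_power_le: "Suc b ^ k \<le> 2 * (max 1 b ^ k * k ^ k)" for b k :: nat
proof -
  have "2 ^ k \<le> 2 * k ^ k"
  proof (cases "k \<le> 1")
    case True
    then show ?thesis by (cases k) auto
  next
    case False
    then have "2 ^ k \<le> k ^ k" by (intro power_mono) auto
    then show ?thesis by simp
  qed
  moreover have "Suc b ^ k \<le> (max 1 b * 2) ^ k"
    by (intro power_mono) auto
  then have "Suc b ^ k \<le> max 1 b ^ k * 2 ^ k"
    by (simp only: power_mult_distrib)
  ultimately show ?thesis
    by (metis mult.left_commute mult_le_mono2 order_trans)
qed

section \<open>The time bound and fixed-parameter tractability\<close>

lemma solve_within:
  "solves_within solve MR_DP
     (\<lambda>x. 4000 * (max 1 (budget x) ^ num_paths x * num_paths x ^ num_paths x * graph_size x ^ 3))"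
  unfolding solves_within_def
proof
  fix x assume "x \<in> instances MR_DP"
  then have "x \<in> mrdp_instances" by (simp add: MR_DP_def)
  from solve_correct[OF this] obtain t \<sigma> ds where
    1: "exec solve (input_store (mrdp_encode x)) t \<sigma>" "output_word \<sigma> (delays_encode ds)"
      "mrdp_optimal (the_graph x) (budget x) (source x) ds"
    and t: "t \<le> 2000 * (graph_size x ^ 3 * Suc (budget x) ^ num_paths x)"
    unfolding runs_def by blast
  have "graph_size x ^ 3 * Suc (budget x) ^ num_paths x \<le>
      graph_size x ^ 3 * (2 * (max 1 (budget x) ^ num_paths x * num_paths x ^ num_paths x))"
    by (intro mult_le_mono2 Suc_power_le)
  then have "t \<le> 2000 * (graph_size x ^ 3 * (2 * (max 1 (budget x) ^ num_paths x * num_paths x ^ num_paths x)))"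
    using t by linarith
  also have "\<dots> = 4000 * (max 1 (budget x) ^ num_paths x * num_paths x ^ num_paths x * graph_size x ^ 3)"
    by (simp add: mult_ac)
  finally have "t \<le> 4000 * (max 1 (budget x) ^ num_paths x * num_paths x ^ num_paths x * graph_size x ^ 3)" .
  with 1 show "\<exists>t \<sigma> ys. exec solve (input_store (encode MR_DP x)) t \<sigma> \<and> output_word \<sigma> ys \<and>
      solution MR_DP x ys \<and>
      t \<le> 4000 * (max 1 (budget x) ^ num_paths x * num_paths x ^ num_paths x * graph_size x ^ 3)"
    by (auto simp: MR_DP_def)
qed

text \<open>Fixed-parameter tractability asks for a computable function of the parameter. Having no
  multiplication, the machine quadruples \<open>y\<close> by additions, \<open>n * n\<close>
  times.\<close>

lemma computable_power_square: "computable (\<lambda>n. C * 4 ^ (n * n))"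
proof -
  let ?step = "Set ''y'' (Plus (Plus (V ''y'') (V ''y'')) (Plus (V ''y'') (V ''y'')))"
  let ?inner = "FOR ''j'' (Inp 1) ?step"
  let ?loop = "FOR ''i'' (Inp 1) ?inner"
  let ?fin = "Seq (Write ''out'' (Const 1) (V ''y'')) (Write ''out'' (Const 0) (Const 1))"
  let ?prog = "Seq (Set ''y'' (Const (int C))) (Seq ?loop ?fin)"
  have "\<exists>t \<sigma>. exec ?prog (input_store [int n]) t \<sigma> \<and> output_word \<sigma> [int (C * 4 ^ (n * n))]" for n
  proof -
    let ?\<sigma> = "input_store [int n]"
    have in1: "?\<sigma> ''in'' 1 = int n" by (simp add: input_store_def)
    define I where "I i \<sigma> \<longleftrightarrow> \<sigma> ''y'' 0 = int (C * 4 ^ (i * n))" for i and \<sigma> :: store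
    have "runs (Set ''y'' (Const (int C))) ?\<sigma> (10 * Suc n ^ 2) (I 0)"
      by (intro runs_straight) (simp_all add: I_def)
    moreover have "runs ?loop \<sigma>1 ((80 + 30) * Suc n ^ Suc 1) (I n)"
      if "I 0 \<sigma>1" and ag1: "agree_off (writes (Set ''y'' (Const (int C)))) ?\<sigma> \<sigma>1" for \<sigma>1
    proof (rule runs_FOR)
      have in1': "\<sigma>1 ''in'' 1 = int n" using agree_offD[OF ag1] in1 by simp
      show "I 0 \<sigma>1" by fact
      show "aval (Inp 1) \<sigma>3 = int n" if "agree_off (insert ''i'' (writes ?inner)) \<sigma>1 \<sigma>3" for \<sigma>3
        using agree_offD[OF that] in1' by simp
      fix i \<sigma>2 assume i: "i < n" "I i \<sigma>2" and ag2: "agree_off (insert ''i'' (writes ?inner)) \<sigma>1 \<sigma>2"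
      have in2: "\<sigma>2 ''in'' 1 = int n" using agree_offD[OF ag2] in1' by simp
      define K where "K j \<sigma> \<longleftrightarrow> \<sigma> ''y'' 0 = int (C * 4 ^ (i * n + j))" for j and \<sigma> :: store
      have "runs ?inner \<sigma>2 ((50 + 30) * Suc n ^ Suc 0) (K n)"
      proof (rule runs_FOR)
        show "K 0 \<sigma>2" using i(2) by (simp add: I_def K_def)
        show "aval (Inp 1) \<sigma>3 = int n" if "agree_off (insert ''j'' (writes ?step)) \<sigma>2 \<sigma>3" for \<sigma>3
          using agree_offD[OF that] in2 by simp
        show "runs ?step \<sigma>3 (50 * Suc n ^ 0) (K (Suc j))" if "K j \<sigma>3" for j \<sigma>3
          using that by (intro runs_straight) (simp_all add: K_def)
      qed (auto simp: K_def)
      then show "runs ?inner \<sigma>2 (80 * Suc n ^ 1) (I (Suc i))"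
        by (rule runs_mono) (simp_all add: K_def I_def algebra_simps)
    qed (auto simp: I_def)
    moreover have "runs ?fin \<sigma>2 (20 * Suc n ^ 2) (\<lambda>\<sigma>. output_word \<sigma> [int (C * 4 ^ (n * n))])" if "I n \<sigma>2" for \<sigma>2
      using that by (intro runs_straight) (simp_all add: I_def output_word_def)
    ultimately have "runs ?prog ?\<sigma> (10 * Suc n ^ 2 + (110 * Suc n ^ 2 + 20 * Suc n ^ 2))
        (\<lambda>\<sigma>. output_word \<sigma> [int (C * 4 ^ (n * n))])"
      by (intro runs_Seq[where ?Q1.0 = "I 0"] runs_Seq[where ?Q1.0 = "I n"]) (simp_all add: numeral_2_eq_2)
    then show ?thesis
      unfolding runs_def by blast
  qed
  then show ?thesis
    unfolding computable_def by blast
qed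

text \<open>The parameter is the single number \<open>b + k\<close>, so the bound must not mention
  \<open>b\<close> and \<open>k\<close> separately. Both bases are at most
  \<open>2 ^ (b + k)\<close> and the exponent \<open>k\<close> is at most \<open>b + k\<close>; the
  two factors together turn the base 2 into 4.\<close>

lemma parameter_power_le: "max 1 b ^ k * k ^ k \<le> 4 ^ ((b + k) * (b + k))" for b k :: nat
proof -
  let ?n = "b + k"
  have bound: "y ^ k \<le> 2 ^ (?n * ?n)" if "y \<le> 2 ^ ?n" for y :: nat
  proof -
    have "y ^ k \<le> (2 ^ ?n) ^ k" using that by (rule power_mono) simp
    also have "\<dots> \<le> (2 ^ ?n) ^ ?n" by (rule power_increasing) simp_all
    finally show ?thesis by (simp add: power_mult)
  qed
  have n: "?n \<le> 2 ^ ?n" by (rule less_imp_le) (rule less_exp)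
  have "b \<le> 2 ^ ?n" "k \<le> 2 ^ ?n" using n by linarith+
  then have "max 1 b \<le> 2 ^ ?n" "k \<le> 2 ^ ?n" by simp_all
  then have "max 1 b ^ k * k ^ k \<le> 2 ^ (?n * ?n) * 2 ^ (?n * ?n)"
    by (intro mult_le_mono bound)
  also have "\<dots> = 4 ^ (?n * ?n)"
    by (simp flip: power_mult_distrib)
  finally show ?thesis .
qed

theorem theorem31:
  shows "fixed_parameter_tractable MR_DP (\<lambda>x. budget x + num_paths x) graph_size \<and>
    (\<exists>c C d. solves_within c MR_DP
       (\<lambda>x. C * (max 1 (budget x) ^ num_paths x * num_paths x ^ num_paths x * graph_size x ^ d)))"
proof
  let ?f = "\<lambda>n. 4000 * 4 ^ (n * n) :: nat"
  have "4000 * (max 1 (budget x) ^ num_paths x * num_paths x ^ num_paths x * graph_size x ^ 3)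
      \<le> ?f (budget x + num_paths x) * graph_size x ^ 3" for x
    using mult_le_mono1[OF parameter_power_le[of "budget x" "num_paths x"], of "4000 * graph_size x ^ 3"]
    by (simp add: mult_ac)
  then have "solves_within solve MR_DP (\<lambda>x. ?f (budget x + num_paths x) * graph_size x ^ 3)"
    using solve_within unfolding solves_within_def by (meson order_trans)
  then show "fixed_parameter_tractable MR_DP (\<lambda>x. budget x + num_paths x) graph_size"
    unfolding fixed_parameter_tractable_def using computable_power_square by blast
  show "\<exists>c C d. solves_within c MR_DP
       (\<lambda>x. C * (max 1 (budget x) ^ num_paths x * num_paths x ^ num_paths x * graph_size x ^ d))"
    using solve_within by blast
qed

end
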